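(* Let $H=\Bbbk^G{}^\tau\#_{\sigma}\Bbbk F$ and let $R:H\otimes H\to\Bbbk$ be a bilinear form on $H$. Then $(H,R)$ is coquasitriangular if and only if the following conditions hold for all $g,h,l\in G$ and $f,f',f''\in F$: (CQT0) $\sum_{x\in G}R(p_x\#1,\,p_g\#f)=\sum_{x\in G}R(p_g\#f,\,p_x\#1)=\delta_{g,1}$; (CQT1) $\delta_{h\triangleleft f',l}\,\sigma(h;f',f'')R(p_g\#f,\,p_h\#f'f'')=\sum_{x\in G}\tau(gx^{-1},x;f)R(p_{gx^{-1}}\#(x\triangleright f),\,p_l\#f'')R(p_x\#f,\,p_h\#f')$; (CQT2) $\delta_{g\triangleleft f,h}\,\sigma(g;f,f')R(p_g\#ff',\,p_l\#f'')=\sum_{x\in G}\tau(lx^{-1},x;f'')R(p_g\#f,\,p_{lx^{-1}}\#(x\triangleright f''))R(p_h\#f',\,p_x\#f'')$; (CQT3) putting $y=l^{-1}h$ and $x=((l^{-1}h)\triangleleft f')(h\triangleleft f')^{-1}g$, the following identity holds in the group algebra $\Bbbk F$: $$\tau(gl^{-1},l;f)\,\tau(h(l\triangleleft f)^{-1},l\triangleleft f;f')\,R\big(p_{gl^{-1}}\#(l\triangleright f),\,p_{h(l\triangleleft f)^{-1}}\#((l\triangleleft f)\triangleright f')\big)\,\sigma(l;f,f')\;ff'$$ $$=\tau\big((h\triangleleft f')(y\triangleleft f')^{-1},\,x;f\big)\,\tau(l,y;f')\,R(p_x\#f,\,p_y\#f')\,\sigma(l;\,y\triangleright f',\,x\triangleright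 f)\;(y\triangleright f')(x\triangleright f).$$ Moreover, $H$ is cotriangular provided that in addition the following is fulfilled for all $g,h\in G$, $f,f'\in F$: (CQT4) $\sum_{x,y\in G}\tau(gx^{-1},x;f)\,\tau(hy^{-1},y;f')\,R(p_{gx^{-1}}\#(x\triangleright f),\,p_{hy^{-1}}\#(y\triangleright f'))\,R(p_y\#f',\,p_x\#f)=\delta_{g,1_G}\delta_{h,1_G}$.
   Context: $\Bbbk$ is an algebraically closed field of characteristic zero, $G$ is a finite group and $F$ is an arbitrary group. $(F,G,\triangleleft,\triangleright)$ is a matched pair of groups: $\triangleleft:G\times F\to G$ is a right action of $F$ on the set $G$ and $\triangleright:G\times F\to F$ is a left action of $G$ on the set $F$, such that $g\triangleright(ff')=(g\triangleright f)((g\triangleleft f)\triangleright f')$ and $(gg')\triangleleft f=(g\triangleleft(g'\triangleright f))(g'\triangleleft f)$ for all $g,g'\in G$, $f,f'\in F$. The maps $\sigma:G\times F\times F\to\Bbbk^\times$ and $\tau:G\times G\times F\to\Bbbk^\times$ satisfy, for all $g,g',g''\in G$, $f,f',f''\in F$: $\sigma(g;1_F,f)=\sigma(g;f,1_F)=\sigma(1_G;f,f')=1$; $\sigma(g\triangleleft f;f',f'')\sigma(g;f,f'f'')=\sigma(g;f,f')\sigma(g;ff',f'')$; $\tau(1_G,g;f)=\tau(g,1_G;f)=\tau(g,g';1_F)=1$; $\tau(g,g';g''\triangleright f)\tau(gg',g'';f)=\tau(g,g'g'';f)\tau(g',g'';f)$; $\sigma(gg';f,f')\tau(g,g';ff')=\sigma(g;g'\triangleright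 f,(g'\triangleleft f)\triangleright f')\,\sigma(g';f,f')\,\tau(g,g';f)\,\tau(g\triangleleft(g'\triangleright f),g'\triangleleft f;f')$. The Hopf algebra $\Bbbk^G{}^\tau\#_{\sigma}\Bbbk F$ is the vector space $\Bbbk^G\otimes\Bbbk F$ with basis $p_g\# f:=p_g\otimes f$ ($g\in G,f\in F$; $\{p_g\}$ is the basis of $\Bbbk^G$ dual to $G\subset\Bbbk G$), multiplication $(p_g\# f)(p_{g'}\# f')=\delta_{g\triangleleft f,g'}\sigma(g;f,f')\,p_g\# ff'$, comultiplication $\Delta(p_g\# f)=\sum_{x\in G}\tau(gx^{-1},x;f)\,(p_{gx^{-1}}\#(x\triangleright f))\otimes(p_x\# f)$, unit $\sum_{g\in G}p_g\#1_F$, counit $\varepsilon(p_g\# f)=\delta_{g,1_G}$, and antipode $S(p_g\# f)=\sigma(g^{-1};g\triangleright f,(g\triangleright f)^{-1})^{-1}\tau(g^{-1},g;f)^{-1}p_{(g\triangleleft f)^{-1}}\#(g\triangleright f)^{-1}$. A pair $(H,R)$ of a Hopf algebra $H$ and a bilinear form $R:H\otimes H\to\Bbbk$ is coquasitriangular if $R$ is convolution-invertible and $R(a,bc)=\sum R(a_{(1)},c)R(a_{(2)},b)$, $R(ab,c)=\sum R(a,c_{(1)})R(b,c_{(2)})$ and $\sum R(a_{(1)},b_{(1)})a_{(2)}b_{(2)}=\sum b_{(1)}a_{(1)}R(a_{(2)},b_{(2)})$ for all $a,b,c\in H$. A coquasitriangular $(H,R)$ is cotriangular if moreover $\sum R(a_{(1)},b_{(1)})R(b_{(2)},a_{(2)})=\varepsilon(a)\varepsilon(b)$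 for all $a,b\in H$. *)

theory Defs
  imports
    "HOL-Algebra.Group"
    "HOL-Computational_Algebra.Polynomial"
    "HOL-Library.Poly_Mapping"
begin

text \<open>
  Vector spaces over a field are represented as free vector spaces on a set \<open>B\<close>: the finitely
  supported functions on \<open>B\<close>. This is no loss of generality, since every vector space has a basis,
  and the tensor product of the free spaces on \<open>B\<close> and \<open>C\<close> is the free space on \<open>B \<times> C\<close>.
\<close>

definition fspace :: "'b set \<Rightarrow> ('b \<Rightarrow>\<^sub>0 'k::zero) set"
  where "fspace B = {v. Poly_Mapping.keys v \<subseteq> B}"

definition fscale :: "'k::mult_zero \<Rightarrow> ('b \<Rightarrow>\<^sub>0 'k) \<Rightarrow> ('b \<Rightarrow>\<^sub>0 'k)"
  where "fscale c v = Poly_Mapping.map ((*) c) v"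

text \<open>
  In the following, \<open>s\<close> is the scalar multiplication of the target space: \<^term>\<open>fscale\<close> for
  vectors, and multiplication for the field itself.
\<close>

definition linear_from ::
    "'b set \<Rightarrow> ('k \<Rightarrow> 'w \<Rightarrow> 'w) \<Rightarrow> (('b \<Rightarrow>\<^sub>0 'k::field) \<Rightarrow> 'w::ab_group_add) \<Rightarrow> bool"
  where "linear_from B s \<phi> \<longleftrightarrow>
    (\<forall>v\<in>fspace B. \<forall>w\<in>fspace B. \<phi> (v + w) = \<phi> v + \<phi> w) \<and>
    (\<forall>c. \<forall>v\<in>fspace B. \<phi> (fscale c v) = s c (\<phi> v))"

definition bilinear_from ::
    "'b set \<Rightarrow> ('k \<Rightarrow> 'w \<Rightarrow> 'w) \<Rightarrow>
      (('b \<Rightarrow>\<^sub>0 'k::field) \<Rightarrow> ('b \<Rightarrow>\<^sub>0 'k) \<Rightarrow> 'w::ab_group_add) \<Rightarrow> bool"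
  where "bilinear_from B s \<beta> \<longleftrightarrow>
    (\<forall>v\<in>fspace B. linear_from B s (\<lambda>w. \<beta> v w)) \<and>
    (\<forall>w\<in>fspace B. linear_from B s (\<lambda>v. \<beta> v w))"

abbreviation bilinear_form ::
    "'b set \<Rightarrow> (('b \<Rightarrow>\<^sub>0 'k::field) \<Rightarrow> ('b \<Rightarrow>\<^sub>0 'k) \<Rightarrow> 'k) \<Rightarrow> bool"
  where "bilinear_form B R \<equiv> bilinear_from B (*) R"

text \<open>The linear map that takes the values \<open>\<phi> b\<close> on the basis vectors \<open>b\<close>.\<close>

definition lin_ext ::
    "('k \<Rightarrow> 'w \<Rightarrow> 'w) \<Rightarrow> ('b \<Rightarrow> 'w) \<Rightarrow> ('b \<Rightarrow>\<^sub>0 'k::zero) \<Rightarrow> 'w::comm_monoid_add"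
  where "lin_ext s \<phi> v = (\<Sum>b\<in>Poly_Mapping.keys v. s (Poly_Mapping.lookup v b) (\<phi> b))"

definition tensor ::
    "('b \<Rightarrow>\<^sub>0 'k::field) \<Rightarrow> ('c \<Rightarrow>\<^sub>0 'k) \<Rightarrow> ('b \<times> 'c \<Rightarrow>\<^sub>0 'k)"
  where "tensor v w =
    lin_ext fscale (\<lambda>b. lin_ext fscale (\<lambda>c. Poly_Mapping.single (b, c) 1) w) v"

text \<open>
  For a bilinear \<open>\<beta>\<close>, the induced linear map on the tensor square: it sends \<open>\<Sum> v \<otimes> w\<close> to
  \<open>\<Sum> \<beta> v w\<close>. Sums in Sweedler notation are obtained by applying it to a comultiplication.
\<close>

definition tensor_lift ::
    "('k \<Rightarrow> 'w \<Rightarrow> 'w) \<Rightarrow> ('b \<times> 'b \<Rightarrow>\<^sub>0 'k::field) \<Rightarrow>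
      (('b \<Rightarrow>\<^sub>0 'k) \<Rightarrow> ('b \<Rightarrow>\<^sub>0 'k) \<Rightarrow> 'w::comm_monoid_add) \<Rightarrow> 'w"
  where "tensor_lift s t \<beta> =
    lin_ext s (\<lambda>(b, c). \<beta> (Poly_Mapping.single b 1) (Poly_Mapping.single c 1)) t"

record (overloaded) ('b, 'k::zero) hopf =
  hbasis :: "'b set"
  hmult :: "('b \<Rightarrow>\<^sub>0 'k) \<Rightarrow> ('b \<Rightarrow>\<^sub>0 'k) \<Rightarrow> ('b \<Rightarrow>\<^sub>0 'k)"
  hunit :: "'b \<Rightarrow>\<^sub>0 'k"
  comult :: "('b \<Rightarrow>\<^sub>0 'k) \<Rightarrow> ('b \<times> 'b \<Rightarrow>\<^sub>0 'k)"
  counit :: "('b \<Rightarrow>\<^sub>0 'k) \<Rightarrow> 'k"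
  antipode :: "('b \<Rightarrow>\<^sub>0 'k) \<Rightarrow> ('b \<Rightarrow>\<^sub>0 'k)"

abbreviation hspace :: "('b, 'k::zero) hopf \<Rightarrow> ('b \<Rightarrow>\<^sub>0 'k) set"
  where "hspace H \<equiv> fspace (hbasis H)"

text \<open>
  \<open>sweedler s H a (\<lambda>a\<^sub>1 a\<^sub>2. \<beta> a\<^sub>1 a\<^sub>2)\<close> is \<open>\<Sum> \<beta>(a\<^sub>(\<^sub>1\<^sub>), a\<^sub>(\<^sub>2\<^sub>))\<close>.
\<close>

abbreviation sweedler ::
    "('k \<Rightarrow> 'w \<Rightarrow> 'w) \<Rightarrow> ('b, 'k::field) hopf \<Rightarrow> ('b \<Rightarrow>\<^sub>0 'k) \<Rightarrow>
      (('b \<Rightarrow>\<^sub>0 'k) \<Rightarrow> ('b \<Rightarrow>\<^sub>0 'k) \<Rightarrow> 'w::comm_monoid_add) \<Rightarrow> 'w"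
  where "sweedler s H a \<beta> \<equiv> tensor_lift s (comult H a) \<beta>"

locale hopf_algebra =
  fixes H :: "('b, 'k::field) hopf"
  assumes mult_bilinear: "bilinear_from (hbasis H) fscale (hmult H)"
    and mult_closed: "\<lbrakk>a \<in> hspace H; b \<in> hspace H\<rbrakk> \<Longrightarrow> hmult H a b \<in> hspace H"
    and mult_assoc: "\<lbrakk>a \<in> hspace H; b \<in> hspace H; c \<in> hspace H\<rbrakk>
      \<Longrightarrow> hmult H (hmult H a b) c = hmult H a (hmult H b c)"
    and unit_closed: "hunit H \<in> hspace H"
    and mult_unit_left: "a \<in> hspace H \<Longrightarrow> hmult H (hunit H) a = a"
    and mult_unit_right: "a \<in> hspace H \<Longrightarrow> hmult H a (hunit H) = a"
    and comult_linear: "linear_from (hbasis H) fscale (comult H)"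
    and comult_closed: "a \<in> hspace H \<Longrightarrow> comult H a \<in> fspace (hbasis H \<times> hbasis H)"
    and comult_coassoc: "a \<in> hspace H
      \<Longrightarrow> Poly_Mapping.lookup
             (sweedler fscale H a (\<lambda>a1 a2. tensor (comult H a1) a2)) ((x, y), z) =
           Poly_Mapping.lookup
             (sweedler fscale H a (\<lambda>a1 a2. tensor a1 (comult H a2))) (x, (y, z))"
    and counit_linear: "linear_from (hbasis H) (*) (counit H)"
    and counit_left: "a \<in> hspace H \<Longrightarrow> sweedler fscale H a (\<lambda>a1 a2. fscale (counit H a1) a2) = a"
    and counit_right: "a \<in> hspace H \<Longrightarrow> sweedler fscale H a (\<lambda>a1 a2. fscale (counit H a2) a1) = a"
    and comult_mult: "\<lbrakk>a \<in> hspace H; b \<in> hspace H\<rbrakk>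
      \<Longrightarrow> comult H (hmult H a b) =
           sweedler fscale H a (\<lambda>a1 a2. sweedler fscale H b (\<lambda>b1 b2.
             tensor (hmult H a1 b1) (hmult H a2 b2)))"
    and comult_unit: "comult H (hunit H) = tensor (hunit H) (hunit H)"
    and counit_mult: "\<lbrakk>a \<in> hspace H; b \<in> hspace H\<rbrakk>
      \<Longrightarrow> counit H (hmult H a b) = counit H a * counit H b"
    and counit_unit: "counit H (hunit H) = 1"
    and antipode_linear: "linear_from (hbasis H) fscale (antipode H)"
    and antipode_closed: "a \<in> hspace H \<Longrightarrow> antipode H a \<in> hspace H"
    and antipode_left: "a \<in> hspace H
      \<Longrightarrow> sweedler fscale H a (\<lambda>a1 a2. hmult H (antipode H a1) a2) = fscale (counit H a) (hunit H)"
    and antipode_right: "a \<in> hspace H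
      \<Longrightarrow> sweedler fscale H a (\<lambda>a1 a2. hmult H a1 (antipode H a2)) = fscale (counit H a) (hunit H)"

text \<open>
  The convolution product of bilinear forms on \<open>H\<close>, i.e. of linear forms on the coalgebra
  \<open>H \<otimes> H\<close>; its neutral element is \<open>\<epsilon> \<otimes> \<epsilon>\<close>.
\<close>

definition convolution ::
    "('b, 'k::field) hopf \<Rightarrow> (('b \<Rightarrow>\<^sub>0 'k) \<Rightarrow> ('b \<Rightarrow>\<^sub>0 'k) \<Rightarrow> 'k) \<Rightarrow>
      (('b \<Rightarrow>\<^sub>0 'k) \<Rightarrow> ('b \<Rightarrow>\<^sub>0 'k) \<Rightarrow> 'k) \<Rightarrow> ('b \<Rightarrow>\<^sub>0 'k) \<Rightarrow> ('b \<Rightarrow>\<^sub>0 'k) \<Rightarrow> 'k"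
  where "convolution H R R' a b =
    sweedler (*) H a (\<lambda>a1 a2. sweedler (*) H b (\<lambda>b1 b2. R a1 b1 * R' a2 b2))"

definition convolution_invertible ::
    "('b, 'k::field) hopf \<Rightarrow> (('b \<Rightarrow>\<^sub>0 'k) \<Rightarrow> ('b \<Rightarrow>\<^sub>0 'k) \<Rightarrow> 'k) \<Rightarrow> bool"
  where "convolution_invertible H R \<longleftrightarrow>
    (\<exists>R'. bilinear_form (hbasis H) R' \<and>
      (\<forall>a\<in>hspace H. \<forall>b\<in>hspace H.
        convolution H R R' a b = counit H a * counit H b \<and>
        convolution H R' R a b = counit H a * counit H b))"

locale coquasitriangular = hopf_algebra H
  for H :: "('b, 'k::field) hopf" +
  fixes R :: "('b \<Rightarrow>\<^sub>0 'k) \<Rightarrow> ('b \<Rightarrow>\<^sub>0 'k) \<Rightarrow> 'k"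
  assumes form_bilinear: "bilinear_form (hbasis H) R"
    and form_invertible: "convolution_invertible H R"
    and form_mult_right: "\<lbrakk>a \<in> hspace H; b \<in> hspace H; c \<in> hspace H\<rbrakk>
      \<Longrightarrow> R a (hmult H b c) = sweedler (*) H a (\<lambda>a1 a2. R a1 c * R a2 b)"
    and form_mult_left: "\<lbrakk>a \<in> hspace H; b \<in> hspace H; c \<in> hspace H\<rbrakk>
      \<Longrightarrow> R (hmult H a b) c = sweedler (*) H c (\<lambda>c1 c2. R a c1 * R b c2)"
    and form_commute: "\<lbrakk>a \<in> hspace H; b \<in> hspace H\<rbrakk>
      \<Longrightarrow> sweedler fscale H a (\<lambda>a1 a2. sweedler fscale H b (\<lambda>b1 b2.
             fscale (R a1 b1) (hmult H a2 b2))) =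
           sweedler fscale H a (\<lambda>a1 a2. sweedler fscale H b (\<lambda>b1 b2.
             fscale (R a2 b2) (hmult H b1 a1)))"

locale cotriangular = coquasitriangular H R
  for H :: "('b, 'k::field) hopf" and R +
  assumes form_triangular: "\<lbrakk>a \<in> hspace H; b \<in> hspace H\<rbrakk>
      \<Longrightarrow> sweedler (*) H a (\<lambda>a1 a2. sweedler (*) H b (\<lambda>b1 b2. R a1 b1 * R b2 a2)) =
           counit H a * counit H b"

locale matched_pair = G: group G + F: group F
  for G :: "('g, 'm) monoid_scheme" and F :: "('f, 'n) monoid_scheme" +
  fixes ract :: "'g \<Rightarrow> 'f \<Rightarrow> 'g" (infixl "\<triangleleft>" 75)
    and lact :: "'g \<Rightarrow> 'f \<Rightarrow> 'f" (infixr "\<triangleright>" 75)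
  assumes ract_closed: "\<lbrakk>g \<in> carrier G; f \<in> carrier F\<rbrakk> \<Longrightarrow> g \<triangleleft> f \<in> carrier G"
    and lact_closed: "\<lbrakk>g \<in> carrier G; f \<in> carrier F\<rbrakk> \<Longrightarrow> g \<triangleright> f \<in> carrier F"
    and ract_one: "g \<in> carrier G \<Longrightarrow> g \<triangleleft> \<one>\<^bsub>F\<^esub> = g"
    and ract_mult: "\<lbrakk>g \<in> carrier G; f \<in> carrier F; f' \<in> carrier F\<rbrakk>
      \<Longrightarrow> g \<triangleleft> (f \<otimes>\<^bsub>F\<^esub> f') = (g \<triangleleft> f) \<triangleleft> f'"
    and lact_one: "f \<in> carrier F \<Longrightarrow> \<one>\<^bsub>G\<^esub> \<triangleright> f = f"
    and lact_mult: "\<lbrakk>g \<in> carrier G; g' \<in> carrier G; f \<in> carrier F\<rbrakk>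
      \<Longrightarrow> (g \<otimes>\<^bsub>G\<^esub> g') \<triangleright> f = g \<triangleright> (g' \<triangleright> f)"
    and lact_matched: "\<lbrakk>g \<in> carrier G; f \<in> carrier F; f' \<in> carrier F\<rbrakk>
      \<Longrightarrow> g \<triangleright> (f \<otimes>\<^bsub>F\<^esub> f') = (g \<triangleright> f) \<otimes>\<^bsub>F\<^esub> ((g \<triangleleft> f) \<triangleright> f')"
    and ract_matched: "\<lbrakk>g \<in> carrier G; g' \<in> carrier G; f \<in> carrier F\<rbrakk>
      \<Longrightarrow> (g \<otimes>\<^bsub>G\<^esub> g') \<triangleleft> f = (g \<triangleleft> (g' \<triangleright> f)) \<otimes>\<^bsub>G\<^esub> (g' \<triangleleft> f)"

locale matched_pair_cocycles = matched_pair G F ract lact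
  for G :: "('g, 'm) monoid_scheme" and F :: "('f, 'n) monoid_scheme"
    and ract :: "'g \<Rightarrow> 'f \<Rightarrow> 'g" (infixl "\<triangleleft>" 75)
    and lact :: "'g \<Rightarrow> 'f \<Rightarrow> 'f" (infixr "\<triangleright>" 75) +
  fixes \<sigma> :: "'g \<Rightarrow> 'f \<Rightarrow> 'f \<Rightarrow> 'k::field"
    and \<tau> :: "'g \<Rightarrow> 'g \<Rightarrow> 'f \<Rightarrow> 'k"
  assumes \<sigma>_nonzero: "\<lbrakk>g \<in> carrier G; f \<in> carrier F; f' \<in> carrier F\<rbrakk> \<Longrightarrow> \<sigma> g f f' \<noteq> 0"
    and \<tau>_nonzero: "\<lbrakk>g \<in> carrier G; g' \<in> carrier G; f \<in> carrier F\<rbrakk> \<Longrightarrow> \<tau> g g' f \<noteq> 0"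
    and \<sigma>_one_left: "\<lbrakk>g \<in> carrier G; f \<in> carrier F\<rbrakk> \<Longrightarrow> \<sigma> g \<one>\<^bsub>F\<^esub> f = 1"
    and \<sigma>_one_right: "\<lbrakk>g \<in> carrier G; f \<in> carrier F\<rbrakk> \<Longrightarrow> \<sigma> g f \<one>\<^bsub>F\<^esub> = 1"
    and \<sigma>_one: "\<lbrakk>f \<in> carrier F; f' \<in> carrier F\<rbrakk> \<Longrightarrow> \<sigma> \<one>\<^bsub>G\<^esub> f f' = 1"
    and \<sigma>_cocycle: "\<lbrakk>g \<in> carrier G; f \<in> carrier F; f' \<in> carrier F; f'' \<in> carrier F\<rbrakk>
      \<Longrightarrow> \<sigma> (g \<triangleleft> f) f' f'' * \<sigma> g f (f' \<otimes>\<^bsub>F\<^esub> f'') = \<sigma> g f f' * \<sigma> g (f \<otimes>\<^bsub>F\<^esub> f') f''"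
    and \<tau>_one_left: "\<lbrakk>g \<in> carrier G; f \<in> carrier F\<rbrakk> \<Longrightarrow> \<tau> \<one>\<^bsub>G\<^esub> g f = 1"
    and \<tau>_one_right: "\<lbrakk>g \<in> carrier G; f \<in> carrier F\<rbrakk> \<Longrightarrow> \<tau> g \<one>\<^bsub>G\<^esub> f = 1"
    and \<tau>_one: "\<lbrakk>g \<in> carrier G; g' \<in> carrier G\<rbrakk> \<Longrightarrow> \<tau> g g' \<one>\<^bsub>F\<^esub> = 1"
    and \<tau>_cocycle: "\<lbrakk>g \<in> carrier G; g' \<in> carrier G; g'' \<in> carrier G; f \<in> carrier F\<rbrakk>
      \<Longrightarrow> \<tau> g g' (g'' \<triangleright> f) * \<tau> (g \<otimes>\<^bsub>G\<^esub> g') g'' f = \<tau> g (g' \<otimes>\<^bsub>G\<^esub> g'') f * \<tau> g' g'' f"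
    and \<sigma>_\<tau>_compatible:
      "\<lbrakk>g \<in> carrier G; g' \<in> carrier G; f \<in> carrier F; f' \<in> carrier F\<rbrakk>
      \<Longrightarrow> \<sigma> (g \<otimes>\<^bsub>G\<^esub> g') f f' * \<tau> g g' (f \<otimes>\<^bsub>F\<^esub> f') =
           \<sigma> g (g' \<triangleright> f) ((g' \<triangleleft> f) \<triangleright> f') * \<sigma> g' f f' * \<tau> g g' f *
           \<tau> (g \<triangleleft> (g' \<triangleright> f)) (g' \<triangleleft> f) f'"

text \<open>The basis vector \<open>p\<^sub>g # f\<close>.\<close>

abbreviation smash_basis :: "'g \<Rightarrow> 'f \<Rightarrow> ('g \<times> 'f \<Rightarrow>\<^sub>0 'k::zero_neq_one)" (infix "\<sharp>" 60)
  where "g \<sharp> f \<equiv> Poly_Mapping.single (g, f) 1"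

context
  fixes G :: "('g, 'm) monoid_scheme" and F :: "('f, 'n) monoid_scheme"
    and ract :: "'g \<Rightarrow> 'f \<Rightarrow> 'g" (infixl "\<triangleleft>" 75)
    and lact :: "'g \<Rightarrow> 'f \<Rightarrow> 'f" (infixr "\<triangleright>" 75)
    and \<sigma> :: "'g \<Rightarrow> 'f \<Rightarrow> 'f \<Rightarrow> 'k::field"
    and \<tau> :: "'g \<Rightarrow> 'g \<Rightarrow> 'f \<Rightarrow> 'k"
begin

definition bicrossed_product :: "('g \<times> 'f, 'k) hopf"
  where "bicrossed_product =
    \<lparr> hbasis = carrier G \<times> carrier F,
      hmult = (\<lambda>a b.
        lin_ext fscale (\<lambda>(g, f). lin_ext fscale (\<lambda>(g', f').
          fscale (of_bool (g \<triangleleft> f = g') * \<sigma> g f f') (g \<sharp> (f \<otimes>\<^bsub>F\<^esub> f'))) b) a),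
      hunit = (\<Sum>g\<in>carrier G. g \<sharp> \<one>\<^bsub>F\<^esub>),
      comult = lin_ext fscale (\<lambda>(g, f). \<Sum>x\<in>carrier G.
        fscale (\<tau> (g \<otimes>\<^bsub>G\<^esub> inv\<^bsub>G\<^esub> x) x f)
          (tensor ((g \<otimes>\<^bsub>G\<^esub> inv\<^bsub>G\<^esub> x) \<sharp> (x \<triangleright> f)) (x \<sharp> f))),
      counit = lin_ext (*) (\<lambda>(g, f). of_bool (g = \<one>\<^bsub>G\<^esub>)),
      antipode = lin_ext fscale (\<lambda>(g, f).
        fscale (inverse (\<sigma> (inv\<^bsub>G\<^esub> g) (g \<triangleright> f) (inv\<^bsub>F\<^esub> (g \<triangleright> f))) * inverse (\<tau> (inv\<^bsub>G\<^esub> g) g f))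
          ((inv\<^bsub>G\<^esub> (g \<triangleleft> f)) \<sharp> (inv\<^bsub>F\<^esub> (g \<triangleright> f)))) \<rparr>"

context
  fixes R :: "('g \<times> 'f \<Rightarrow>\<^sub>0 'k) \<Rightarrow> ('g \<times> 'f \<Rightarrow>\<^sub>0 'k) \<Rightarrow> 'k"
begin

definition CQT0 :: bool
  where "CQT0 \<longleftrightarrow> (\<forall>g\<in>carrier G. \<forall>f\<in>carrier F.
    (\<Sum>x\<in>carrier G. R (x \<sharp> \<one>\<^bsub>F\<^esub>) (g \<sharp> f)) = of_bool (g = \<one>\<^bsub>G\<^esub>) \<and>
    (\<Sum>x\<in>carrier G. R (g \<sharp> f) (x \<sharp> \<one>\<^bsub>F\<^esub>)) = of_bool (g = \<one>\<^bsub>G\<^esub>))"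

definition CQT1 :: bool
  where "CQT1 \<longleftrightarrow> (\<forall>g\<in>carrier G. \<forall>h\<in>carrier G. \<forall>l\<in>carrier G.
      \<forall>f\<in>carrier F. \<forall>f'\<in>carrier F. \<forall>f''\<in>carrier F.
    of_bool (h \<triangleleft> f' = l) * \<sigma> h f' f'' * R (g \<sharp> f) (h \<sharp> (f' \<otimes>\<^bsub>F\<^esub> f'')) =
    (\<Sum>x\<in>carrier G. \<tau> (g \<otimes>\<^bsub>G\<^esub> inv\<^bsub>G\<^esub> x) x f *
      R ((g \<otimes>\<^bsub>G\<^esub> inv\<^bsub>G\<^esub> x) \<sharp> (x \<triangleright> f)) (l \<sharp> f'') * R (x \<sharp> f) (h \<sharp> f')))"

definition CQT2 :: bool
  where "CQT2 \<longleftrightarrow> (\<forall>g\<in>carrier G. \<forall>h\<in>carrier G. \<forall>l\<in>carrier G.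
      \<forall>f\<in>carrier F. \<forall>f'\<in>carrier F. \<forall>f''\<in>carrier F.
    of_bool (g \<triangleleft> f = h) * \<sigma> g f f' * R (g \<sharp> (f \<otimes>\<^bsub>F\<^esub> f')) (l \<sharp> f'') =
    (\<Sum>x\<in>carrier G. \<tau> (l \<otimes>\<^bsub>G\<^esub> inv\<^bsub>G\<^esub> x) x f'' *
      R (g \<sharp> f) ((l \<otimes>\<^bsub>G\<^esub> inv\<^bsub>G\<^esub> x) \<sharp> (x \<triangleright> f'')) * R (h \<sharp> f') (x \<sharp> f'')))"

text \<open>
  The identity holds in the group algebra of \<open>F\<close>, whose basis vectors are the
  \<open>Poly_Mapping.single u 1\<close> for \<open>u \<in> carrier F\<close>.
\<close>

definition CQT3 :: bool
  where "CQT3 \<longleftrightarrow> (\<forall>g\<in>carrier G. \<forall>h\<in>carrier G. \<forall>l\<in>carrier G.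
      \<forall>f\<in>carrier F. \<forall>f'\<in>carrier F.
    let y = inv\<^bsub>G\<^esub> l \<otimes>\<^bsub>G\<^esub> h;
        x = ((inv\<^bsub>G\<^esub> l \<otimes>\<^bsub>G\<^esub> h) \<triangleleft> f') \<otimes>\<^bsub>G\<^esub> inv\<^bsub>G\<^esub> (h \<triangleleft> f') \<otimes>\<^bsub>G\<^esub> g
    in
      fscale
        (\<tau> (g \<otimes>\<^bsub>G\<^esub> inv\<^bsub>G\<^esub> l) l f *
         \<tau> (h \<otimes>\<^bsub>G\<^esub> inv\<^bsub>G\<^esub> (l \<triangleleft> f)) (l \<triangleleft> f) f' *
         R ((g \<otimes>\<^bsub>G\<^esub> inv\<^bsub>G\<^esub> l) \<sharp> (l \<triangleright> f))
           ((h \<otimes>\<^bsub>G\<^esub> inv\<^bsub>G\<^esub> (l \<triangleleft> f)) \<sharp> ((l \<triangleleft> f) \<triangleright> f')) *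
         \<sigma> l f f')
        (Poly_Mapping.single (f \<otimes>\<^bsub>F\<^esub> f') 1) =
      fscale
        (\<tau> ((h \<triangleleft> f') \<otimes>\<^bsub>G\<^esub> inv\<^bsub>G\<^esub> (y \<triangleleft> f')) x f *
         \<tau> l y f' *
         R (x \<sharp> f) (y \<sharp> f') *
         \<sigma> l (y \<triangleright> f') (x \<triangleright> f))
        (Poly_Mapping.single ((y \<triangleright> f') \<otimes>\<^bsub>F\<^esub> (x \<triangleright> f)) 1))"

definition CQT4 :: bool
  where "CQT4 \<longleftrightarrow> (\<forall>g\<in>carrier G. \<forall>h\<in>carrier G. \<forall>f\<in>carrier F. \<forall>f'\<in>carrier F.
    (\<Sum>x\<in>carrier G. \<Sum>y\<in>carrier G.
      \<tau> (g \<otimes>\<^bsub>G\<^esub> inv\<^bsub>G\<^esub> x) x f * \<tau> (h \<otimes>\<^bsub>G\<^esub> inv\<^bsub>G\<^esub> y) y f' *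
      R ((g \<otimes>\<^bsub>G\<^esub> inv\<^bsub>G\<^esub> x) \<sharp> (x \<triangleright> f)) ((h \<otimes>\<^bsub>G\<^esub> inv\<^bsub>G\<^esub> y) \<sharp> (y \<triangleright> f')) *
      R (y \<sharp> f') (x \<sharp> f)) =
    of_bool (g = \<one>\<^bsub>G\<^esub>) * of_bool (h = \<one>\<^bsub>G\<^esub>))"

end

end

end

theory Submission
  imports Defs
begin

text \<open>
  Write \<open>H\<close> for the bicrossed product and \<open>k\<close> for the field. All axioms of a coquasitriangular structure
  except convolution invertibility are equalities of multilinear maps on \<open>H\<close>, so they hold if and only
  if they hold on the basis vectors \<open>p\<^sub>g # f\<close>. Evaluated there, multiplicativity of \<open>R\<close> in the second and
  in the first argument is exactly \<open>CQT1\<close> and \<open>CQT2\<close>. Both sides of the commutation rule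
  \<open>\<Sum> R(a\<^sub>(\<^sub>1\<^sub>), b\<^sub>(\<^sub>1\<^sub>)) a\<^sub>(\<^sub>2\<^sub>) b\<^sub>(\<^sub>2\<^sub>) = \<Sum> b\<^sub>(\<^sub>1\<^sub>) a\<^sub>(\<^sub>1\<^sub>) R(a\<^sub>(\<^sub>2\<^sub>), b\<^sub>(\<^sub>2\<^sub>))\<close> become double sums over \<open>G\<close> in which the idempotents
  leave one term for each \<open>p\<^sub>l\<close>; comparing the \<open>p\<^sub>l\<close>-components for each \<open>l\<close> gives \<open>CQT3\<close>
  (\<open>form_commute_basis_iff\<close>).

  \<open>CQT0\<close> says that \<open>R(1, a) = R(a, 1) = \<epsilon>(a)\<close>, and it replaces invertibility. In one direction, for a
  coquasitriangular structure on any Hopf algebra, \<open>R(1, \<cdot>)\<close> and \<open>R(\<cdot>, 1)\<close> are invertible idempotents of the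
  convolution algebra, hence equal to \<open>\<epsilon>\<close> (\<open>form_unit\<close>). In the other direction, a form that is
  multiplicative in the first argument and satisfies \<open>R(1, b) = \<epsilon>(b)\<close> has the convolution inverse
  \<open>R(S(a), b)\<close> (\<open>convolution_invertible_if_multiplicative\<close>).

  A coquasitriangular structure lives on a Hopf algebra by definition, so the implication from the
  conditions to coquasitriangularity also requires the Hopf algebra axioms for \<open>H\<close>
  (\<open>hopf_algebra_H\<close>). They are checked on basis vectors as well: the matched pair identities decide
  which summands are nonzero, and the cocycle identities make the scalars agree.

  \<open>CQT4\<close> is the remaining axiom of a cotriangular structure on basis vectors (\<open>CQT4_imp\<close>).
\<close>

section \<open>Linear maps on free vector spaces\<close>

lemma lookup_fscale: "Poly_Mapping.lookup (fscale c v) b = c * Poly_Mapping.lookup v b"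
  for c :: "'k::field"
  by (simp add: fscale_def Poly_Mapping.map.rep_eq when_def)

lemma vector_space_fscale [simp]: "vector_space (fscale :: 'k::field \<Rightarrow> ('b \<Rightarrow>\<^sub>0 'k) \<Rightarrow> _)"
  by unfold_locales (auto intro!: poly_mapping_eqI simp: lookup_fscale lookup_add algebra_simps)

lemma vector_space_mult [simp]: "vector_space ((*) :: 'k::field \<Rightarrow> 'k \<Rightarrow> 'k)"
  by unfold_locales (auto simp: algebra_simps)

lemma vector_space_scale_one [simp]: "vector_space s \<Longrightarrow> s 1 x = x"
  by (rule vector_space.vector_space_assms(4))

lemma fscale_single [simp]: "fscale c (Poly_Mapping.single b d) = Poly_Mapping.single b (c * d)"
  for c :: "'k::field"
  by (intro poly_mapping_eqI) (simp add: lookup_fscale lookup_single when_def)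

lemma single_mem_fspace [simp]: "b \<in> B \<Longrightarrow> Poly_Mapping.single b c \<in> fspace B"
  by (auto simp: fspace_def lookup_single when_def in_keys_iff split: if_splits)

lemma zero_mem_fspace [simp]: "0 \<in> fspace B"
  by (simp add: fspace_def)

lemma add_mem_fspace: "v \<in> fspace B \<Longrightarrow> w \<in> fspace B \<Longrightarrow> v + w \<in> fspace B"
  using keys_add[of v w] by (auto simp: fspace_def)

lemma fscale_mem_fspace: "v \<in> fspace B \<Longrightarrow> fscale c v \<in> fspace B"
  for c :: "'k::field"
  by (auto simp: fspace_def lookup_fscale in_keys_iff)

lemma sum_mem_fspace: "(\<And>i. i \<in> I \<Longrightarrow> v i \<in> fspace B) \<Longrightarrow> (\<Sum>i\<in>I. v i) \<in> fspace B"
  by (induction I rule: infinite_finite_induct) (auto intro: add_mem_fspace)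

lemma lin_ext_mem_fspace:
  fixes v :: "'b \<Rightarrow>\<^sub>0 'k::field"
  shows "(\<And>b. b \<in> Poly_Mapping.keys v \<Longrightarrow> \<phi> b \<in> fspace C) \<Longrightarrow> lin_ext fscale \<phi> v \<in> fspace C"
  unfolding lin_ext_def by (intro sum_mem_fspace fscale_mem_fspace)

lemma linear_from_add:
  "linear_from B s \<phi> \<Longrightarrow> v \<in> fspace B \<Longrightarrow> w \<in> fspace B \<Longrightarrow> \<phi> (v + w) = \<phi> v + \<phi> w"
  by (simp add: linear_from_def)

lemma linear_from_fscale: "linear_from B s \<phi> \<Longrightarrow> v \<in> fspace B \<Longrightarrow> \<phi> (fscale c v) = s c (\<phi> v)"
  by (simp add: linear_from_def)

lemma linear_from_zero: "linear_from B s \<phi> \<Longrightarrow> \<phi> 0 = 0"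
  using linear_from_add[of B s \<phi> 0 0] by simp

lemma linear_from_sum:
  assumes "linear_from B s \<phi>" "\<And>i. i \<in> I \<Longrightarrow> v i \<in> fspace B"
  shows "\<phi> (\<Sum>i\<in>I. v i) = (\<Sum>i\<in>I. \<phi> (v i))"
  using assms(2)
  by (induction I rule: infinite_finite_induct)
    (auto simp: linear_from_zero[OF assms(1)] linear_from_add[OF assms(1)] sum_mem_fspace)

lemma fspace_expansion:
  fixes v :: "'b \<Rightarrow>\<^sub>0 'k::field"
  shows "v = (\<Sum>b\<in>Poly_Mapping.keys v. fscale (Poly_Mapping.lookup v b) (Poly_Mapping.single b 1))"
  by (intro poly_mapping_eqI)
    (auto simp: lookup_sum lookup_single when_def in_keys_iff)

text \<open>
  Every multilinear identity below is reduced to basis vectors with this lemma and its two- and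
  three-argument versions. Linearity is required on \<^term>\<open>fspace B\<close> only, because a bilinear
  form \<open>R\<close> may take arbitrary values at vectors with support outside \<open>B\<close>.
\<close>

lemma linear_from_eqI:
  assumes "linear_from B s \<phi>" "linear_from B s \<psi>"
    and basis: "\<And>b. b \<in> B \<Longrightarrow> \<phi> (Poly_Mapping.single b 1) = \<psi> (Poly_Mapping.single b 1)"
    and v: "v \<in> fspace B"
  shows "\<phi> v = \<psi> v"
proof -
  have B: "b \<in> B" if "b \<in> Poly_Mapping.keys v" for b
    using that v by (auto simp: fspace_def)
  have exp: "\<chi> v = (\<Sum>b\<in>Poly_Mapping.keys v. s (Poly_Mapping.lookup v b) (\<chi> (Poly_Mapping.single b 1)))"
    if \<chi>: "linear_from B s \<chi>" for \<chi>
  proof -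
    have "\<chi> v = (\<Sum>b\<in>Poly_Mapping.keys v.
        \<chi> (fscale (Poly_Mapping.lookup v b) (Poly_Mapping.single b 1)))"
      by (subst fspace_expansion[of v], rule linear_from_sum[OF \<chi>])
        (intro fscale_mem_fspace single_mem_fspace B)
    also have "\<dots> = (\<Sum>b\<in>Poly_Mapping.keys v. s (Poly_Mapping.lookup v b) (\<chi> (Poly_Mapping.single b 1)))"
      by (intro sum.cong refl linear_from_fscale[OF \<chi>] single_mem_fspace B)
    finally show ?thesis .
  qed
  show ?thesis
    unfolding exp[OF assms(1)] exp[OF assms(2)] by (intro sum.cong refl) (simp add: basis B)
qed

lemma fspaceD: "v \<in> fspace B \<Longrightarrow> b \<in> Poly_Mapping.keys v \<Longrightarrow> b \<in> B"
  by (auto simp: fspace_def)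

lemma bilinear_eqI:
  assumes "bilinear_from B s \<phi>" "bilinear_from B s \<psi>"
    and "\<And>b c. b \<in> B \<Longrightarrow> c \<in> B \<Longrightarrow> \<phi> (Poly_Mapping.single b 1) (Poly_Mapping.single c 1) =
      \<psi> (Poly_Mapping.single b 1) (Poly_Mapping.single c 1)"
    and v: "v \<in> fspace B" and w: "w \<in> fspace B"
  shows "\<phi> v w = \<psi> v w"
proof -
  have "\<phi> (Poly_Mapping.single b 1) w = \<psi> (Poly_Mapping.single b 1) w" if "b \<in> B" for b
    by (rule linear_from_eqI[where B = B and s = s, OF _ _ _ w])
      (use assms that in \<open>auto simp: bilinear_from_def\<close>)
  with assms show ?thesis
    by - (rule linear_from_eqI[where B = B and s = s and v = v, OF _ _ _ v],
      use assms in \<open>auto simp: bilinear_from_def\<close>)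
qed

lemma trilinear_eqI:
  assumes "\<And>v. v \<in> fspace B \<Longrightarrow> bilinear_from B s (\<phi> v)" "\<And>v. v \<in> fspace B \<Longrightarrow> bilinear_from B s (\<psi> v)"
    and "\<And>w u. w \<in> fspace B \<Longrightarrow> u \<in> fspace B \<Longrightarrow> linear_from B s (\<lambda>v. \<phi> v w u)"
    and "\<And>w u. w \<in> fspace B \<Longrightarrow> u \<in> fspace B \<Longrightarrow> linear_from B s (\<lambda>v. \<psi> v w u)"
    and "\<And>b c d. b \<in> B \<Longrightarrow> c \<in> B \<Longrightarrow> d \<in> B \<Longrightarrow>
      \<phi> (Poly_Mapping.single b 1) (Poly_Mapping.single c 1) (Poly_Mapping.single d 1) =
      \<psi> (Poly_Mapping.single b 1) (Poly_Mapping.single c 1) (Poly_Mapping.single d 1)"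
    and v: "v \<in> fspace B" and w: "w \<in> fspace B" and u: "u \<in> fspace B"
  shows "\<phi> v w u = \<psi> v w u"
proof (rule linear_from_eqI[where B = B and s = s and v = v, OF _ _ _ v])
  fix b assume "b \<in> B"
  with assms show "\<phi> (Poly_Mapping.single b 1) w u = \<psi> (Poly_Mapping.single b 1) w u"
    by - (rule bilinear_eqI[where B = B and s = s, OF _ _ _ w u], auto)
qed (use assms in auto)

lemma lin_ext_superset:
  assumes "vector_space s" "finite S" "Poly_Mapping.keys v \<subseteq> S"
  shows "lin_ext s \<phi> v = (\<Sum>b\<in>S. s (Poly_Mapping.lookup v b) (\<phi> b))"
proof -
  interpret vector_space s by fact
  show ?thesis unfolding lin_ext_def
    using assms(2,3) by (intro sum.mono_neutral_left) (auto simp: in_keys_iff)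
qed

lemma lin_ext_single [simp]: "vector_space s \<Longrightarrow> lin_ext s \<phi> (Poly_Mapping.single b c) = s c (\<phi> b)"
  by (subst lin_ext_superset[where S = "{b}"]) auto

lemma linear_from_lin_ext: "vector_space s \<Longrightarrow> linear_from B s (lin_ext s \<phi>)"
proof -
  assume s: "vector_space s"
  then interpret vector_space s .
  have "lin_ext s \<phi> (v + w) = lin_ext s \<phi> v + lin_ext s \<phi> w" for v w
    using keys_add[of v w]
    by (simp add: lin_ext_superset[OF s, where S = "Poly_Mapping.keys v \<union> Poly_Mapping.keys w"]
        lookup_add scale_left_distrib sum.distrib)
  moreover have "lin_ext s \<phi> (fscale c v) = s c (lin_ext s \<phi> v)" for c v
    by (subst (1 2) lin_ext_superset[OF s, where S = "Poly_Mapping.keys v"])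
      (auto simp: lookup_fscale in_keys_iff scale_sum_right)
  ultimately show ?thesis by (simp add: linear_from_def)
qed

lemma lin_ext_fscale: "vector_space s \<Longrightarrow> lin_ext s \<phi> (fscale c v) = s c (lin_ext s \<phi> v)"
  by (rule linear_from_fscale[OF linear_from_lin_ext, where B = UNIV]) (auto simp: fspace_def)

lemma lin_ext_sum: "vector_space s \<Longrightarrow> lin_ext s \<phi> (\<Sum>i\<in>I. v i) = (\<Sum>i\<in>I. lin_ext s \<phi> (v i))"
  by (rule linear_from_sum[OF linear_from_lin_ext, where B = UNIV]) (auto simp: fspace_def)

lemma linear_from_comp:
  assumes "linear_from C s \<psi>" "linear_from B fscale \<phi>" "\<And>v. v \<in> fspace B \<Longrightarrow> \<phi> v \<in> fspace C"
  shows "linear_from B s (\<lambda>v. \<psi> (\<phi> v))"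
  using assms by (simp add: linear_from_def)

lemma linear_from_id: "linear_from B fscale (\<lambda>v. v)"
  by (simp add: linear_from_def)

lemma linear_from_lin_ext_comp:
  "vector_space s \<Longrightarrow> linear_from B fscale \<psi> \<Longrightarrow> linear_from B s (\<lambda>v. lin_ext s \<phi> (\<psi> v))"
  by (rule linear_from_comp[OF linear_from_lin_ext, where C = UNIV]) (auto simp: fspace_def)

lemma linear_from_sum_fun:
  assumes "vector_space s" "\<And>i. i \<in> I \<Longrightarrow> linear_from B s (\<lambda>v. \<phi> v i)"
  shows "linear_from B s (\<lambda>v. \<Sum>i\<in>I. \<phi> v i)"
proof -
  interpret vector_space s by fact
  show ?thesis using assms(2) by (simp add: linear_from_def sum.distrib scale_sum_right)
qed

lemma linear_from_scale_right:
  assumes "vector_space s" "linear_from B s \<phi>"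
  shows "linear_from B s (\<lambda>v. s c (\<phi> v))"
proof -
  interpret vector_space s by fact
  show ?thesis using assms(2)
    by (simp add: linear_from_def scale_right_distrib scale_left_commute)
qed

lemma linear_from_scale_left:
  assumes "vector_space s" "linear_from B (*) \<phi>"
  shows "linear_from B s (\<lambda>v. s (\<phi> v) w)"
proof -
  interpret vector_space s by fact
  show ?thesis using assms(2)
    by (simp add: linear_from_def scale_left_distrib)
qed

lemma linear_from_lin_ext_param:
  assumes "vector_space s" "\<And>b. b \<in> Poly_Mapping.keys w \<Longrightarrow> linear_from B s (\<lambda>v. \<phi> v b)"
  shows "linear_from B s (\<lambda>v. lin_ext s (\<phi> v) w)"
  unfolding lin_ext_def by (intro linear_from_sum_fun linear_from_scale_right assms)

lemma lin_ext_lin_ext: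
  "vector_space s \<Longrightarrow> lin_ext s \<phi> (lin_ext fscale \<psi> v) = lin_ext s (\<lambda>b. lin_ext s \<phi> (\<psi> b)) v"
  by (simp add: lin_ext_def[of fscale] lin_ext_def[of s _ v] lin_ext_sum lin_ext_fscale)

lemma linear_from_lookup:
  "linear_from B fscale \<phi> \<Longrightarrow> linear_from B (*) (\<lambda>v. Poly_Mapping.lookup (\<phi> v) b)"
  by (simp add: linear_from_def lookup_add lookup_fscale)

lemma tensor_single [simp]:
  "tensor (Poly_Mapping.single b c) (Poly_Mapping.single b' c') = Poly_Mapping.single (b, b') (c * c')"
  by (simp add: tensor_def)

lemma lin_ext_tensor:
  "vector_space s \<Longrightarrow> lin_ext s \<phi> (tensor v w) = lin_ext s (\<lambda>b. lin_ext s (\<lambda>c. \<phi> (b, c)) w) v"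
  by (simp add: tensor_def lin_ext_lin_ext vector_space_scale_one)

lemma linear_from_tensor_left:
  "linear_from B fscale \<phi> \<Longrightarrow> linear_from B fscale (\<lambda>v. tensor (\<phi> v) w)"
  unfolding tensor_def by (simp add: linear_from_lin_ext_comp)

lemma linear_from_tensor_right:
  "linear_from B fscale \<phi> \<Longrightarrow> linear_from B fscale (\<lambda>v. tensor w (\<phi> v))"
  unfolding tensor_def by (simp add: linear_from_lin_ext_comp linear_from_lin_ext_param)

lemma tensor_sum_left: "tensor (\<Sum>i\<in>I. v i) w = (\<Sum>i\<in>I. tensor (v i) w)"
  by (rule linear_from_sum[OF linear_from_tensor_left[OF linear_from_id], where B = UNIV])
    (simp add: fspace_def)

lemma tensor_sum_right: "tensor w (\<Sum>i\<in>I. v i) = (\<Sum>i\<in>I. tensor w (v i))"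
  by (rule linear_from_sum[OF linear_from_tensor_right[OF linear_from_id], where B = UNIV])
    (simp add: fspace_def)

lemma linear_from_tensor_lift_comp:
  "vector_space s \<Longrightarrow> linear_from B fscale \<phi> \<Longrightarrow> linear_from B s (\<lambda>v. tensor_lift s (\<phi> v) \<beta>)"
  unfolding tensor_lift_def by (rule linear_from_lin_ext_comp)

lemma linear_from_tensor_lift_param:
  assumes "vector_space s"
    and "\<And>b c. (b, c) \<in> Poly_Mapping.keys t \<Longrightarrow>
      linear_from B s (\<lambda>v. \<beta> v (Poly_Mapping.single b 1) (Poly_Mapping.single c 1))"
  shows "linear_from B s (\<lambda>v. tensor_lift s t (\<beta> v))"
  unfolding tensor_lift_def
  by (rule linear_from_lin_ext_param[OF assms(1)]) (use assms(2) in auto)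

lemma tensor_lift_cong:
  assumes "\<And>b c. (b, c) \<in> Poly_Mapping.keys t \<Longrightarrow>
      \<beta> (Poly_Mapping.single b 1) (Poly_Mapping.single c 1) =
      \<beta>' (Poly_Mapping.single b 1) (Poly_Mapping.single c 1)"
  shows "tensor_lift s t \<beta> = tensor_lift s t \<beta>'"
  unfolding tensor_lift_def lin_ext_def
  by (intro sum.cong refl) (use assms in \<open>auto split: prod.splits\<close>)

lemma lin_ext_tensor_lift:
  "vector_space s \<Longrightarrow>
    lin_ext s \<phi> (tensor_lift fscale t \<beta>) = tensor_lift s t (\<lambda>x y. lin_ext s \<phi> (\<beta> x y))"
  by (simp add: tensor_lift_def lin_ext_lin_ext case_prod_unfold)

text \<open>This moves a linear functional, such as \<open>R\<close> with one fixed argument, into a Sweedler sum.\<close>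

lemma linear_from_tensor_lift:
  assumes "linear_from C s \<psi>"
    and "\<And>b c. (b, c) \<in> Poly_Mapping.keys t \<Longrightarrow>
      \<beta> (Poly_Mapping.single b 1) (Poly_Mapping.single c 1) \<in> fspace C"
  shows "\<psi> (tensor_lift fscale t \<beta>) = tensor_lift s t (\<lambda>x y. \<psi> (\<beta> x y))"
proof -
  have "\<psi> (tensor_lift fscale t \<beta>) = (\<Sum>b\<in>Poly_Mapping.keys t. \<psi> (fscale (Poly_Mapping.lookup t b)
      (case b of (b, c) \<Rightarrow> \<beta> (Poly_Mapping.single b 1) (Poly_Mapping.single c 1))))"
    unfolding tensor_lift_def lin_ext_def
    by (rule linear_from_sum[OF assms(1)]) (use assms(2) in \<open>auto intro!: fscale_mem_fspace\<close>)
  also have "\<dots> = tensor_lift s t (\<lambda>x y. \<psi> (\<beta> x y))"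
    unfolding tensor_lift_def lin_ext_def
    by (intro sum.cong refl) (use assms(2) in \<open>auto simp: linear_from_fscale[OF assms(1)]\<close>)
  finally show ?thesis .
qed

lemma tensor_lift_single [simp]:
  "vector_space s \<Longrightarrow> tensor_lift s (Poly_Mapping.single (b, c) d) \<beta> =
    s d (\<beta> (Poly_Mapping.single b 1) (Poly_Mapping.single c 1))"
  by (simp add: tensor_lift_def)

lemma tensor_lift_sum:
  "vector_space s \<Longrightarrow> tensor_lift s (\<Sum>i\<in>I. t i) \<beta> = (\<Sum>i\<in>I. tensor_lift s (t i) \<beta>)"
  by (simp add: tensor_lift_def lin_ext_sum)

lemma tensor_lift_tensor:
  assumes s: "vector_space s" and \<beta>: "bilinear_from B s \<beta>" and v: "v \<in> fspace B" and w: "w \<in> fspace B"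
  shows "tensor_lift s (tensor v w) \<beta> = \<beta> v w"
proof -
  have *: "tensor_lift s (tensor (Poly_Mapping.single b 1) w) \<beta> = \<beta> (Poly_Mapping.single b 1) w"
    if "b \<in> B" for b
    by (rule linear_from_eqI[where B = B and s = s, OF _ _ _ w])
      (use that s \<beta> in \<open>auto intro!: linear_from_tensor_lift_comp linear_from_tensor_right linear_from_id
         simp: bilinear_from_def\<close>)
  show ?thesis
    by (rule linear_from_eqI[where B = B and s = s and v = v, OF _ _ _ v])
      (use * s \<beta> w in \<open>auto intro!: linear_from_tensor_lift_comp linear_from_tensor_left linear_from_id
         simp: bilinear_from_def\<close>)
qed

lemma bilinear_from_mult:
  assumes "linear_from B (*) \<phi>" "linear_from B (*) \<psi>"
  shows "bilinear_from B (*) (\<lambda>x y. \<phi> x * \<psi> y)"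
  using assms by (auto simp: bilinear_from_def linear_from_def algebra_simps)

lemma fscale_sum: "fscale c (\<Sum>i\<in>I. v i) = (\<Sum>i\<in>I. fscale c (v i))" for c :: "'k::field"
  by (intro poly_mapping_eqI) (simp add: lookup_fscale lookup_sum sum_distrib_left)

lemma sum_eq_single_term:
  "finite A \<Longrightarrow> a \<in> A \<Longrightarrow> (\<And>x. x \<in> A \<Longrightarrow> x \<noteq> a \<Longrightarrow> f x = 0) \<Longrightarrow> sum f A = f a"
  by (subst sum.remove) auto

text \<open>
  Vectors of \<open>k\<^sup>G \<otimes> kF\<close> whose components at the idempotents \<open>p\<^sub>l\<close> are multiples of one group element
  each are compared component by component. This is what turns an identity in the bicrossed product
  into a family of identities in the group algebra of \<open>F\<close>, indexed by \<open>l\<close>.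
\<close>

lemma sum_single_eq_iff:
  assumes "finite A"
  shows "(\<Sum>l\<in>A. Poly_Mapping.single (l, u l) (c l)) = (\<Sum>l\<in>A. Poly_Mapping.single (l, v l) (d l)) \<longleftrightarrow>
    (\<forall>l\<in>A. Poly_Mapping.single (u l) (c l) = Poly_Mapping.single (v l) (d l))" (is "?L = ?R \<longleftrightarrow> _")
proof -
  have lookup: "Poly_Mapping.lookup (\<Sum>l\<in>A. Poly_Mapping.single (l, w l) (e l)) (l, k) =
      (if l \<in> A then Poly_Mapping.lookup (Poly_Mapping.single (w l) (e l)) k else 0)" for w e l k
    unfolding lookup_sum lookup_single using assms
    by (auto intro!: sum.neutral simp: when_def
        intro: trans[OF sum_eq_single_term[where a = l]])
  show ?thesis
    by (auto simp: poly_mapping_eq_iff fun_eq_iff lookup split: if_splits)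
qed

section \<open>Forms on an arbitrary Hopf algebra\<close>

context hopf_algebra
begin

lemma comult_keys:
  assumes "a \<in> hspace H" "(b, c) \<in> Poly_Mapping.keys (comult H a)"
  shows "Poly_Mapping.single b 1 \<in> hspace H" "Poly_Mapping.single c 1 \<in> hspace H"
  using comult_closed[OF assms(1)] assms(2) by (auto simp: fspace_def)

text \<open>
  Coassociativity is an equality of coefficients of tensors. As \<^const>\<open>tensor_lift\<close> only evaluates
  \<open>\<beta>\<close> at basis vectors, applying \<^const>\<open>lin_ext\<close> to both tensors gives the Sweedler form for an
  arbitrary function \<open>\<beta>\<close>.
\<close>

lemma sweedler_coassoc:
  assumes s: "vector_space s" and a: "a \<in> hspace H"
  shows "sweedler s H a (\<lambda>a1 a3. sweedler s H a1 (\<lambda>a1 a2. \<beta> a1 a2 a3)) =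
    sweedler s H a (\<lambda>a1 a2. sweedler s H a2 (\<lambda>a2 a3. \<beta> a1 a2 a3))"
proof -
  let ?e = "\<lambda>b. Poly_Mapping.single b 1"
  let ?\<phi> = "\<lambda>((x, y), z). \<beta> (?e x) (?e y) (?e z)"
  let ?\<psi> = "\<lambda>(x, y, z). \<beta> (?e x) (?e y) (?e z)"
  let ?v = "sweedler fscale H a (\<lambda>a1 a2. tensor (comult H a1) a2)"
  let ?w = "sweedler fscale H a (\<lambda>a1 a2. tensor a1 (comult H a2))"
  have "sweedler s H a (\<lambda>a1 a3. sweedler s H a1 (\<lambda>a1 a2. \<beta> a1 a2 a3)) = lin_ext s ?\<phi> ?v"
    using s by (auto simp: lin_ext_tensor_lift lin_ext_tensor vector_space_scale_one
        tensor_lift_def[of s "comult H _"] case_prod_unfold intro!: tensor_lift_cong)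
  also have "lin_ext s ?\<phi> ?v = lin_ext s ?\<psi> ?w"
    unfolding lin_ext_def using comult_coassoc[OF a]
    by (intro sum.reindex_bij_witness[where i = "\<lambda>(x, y, z). ((x, y), z)"
          and j = "\<lambda>((x, y), z). (x, y, z)"])
      (auto simp: in_keys_iff)
  also have "lin_ext s ?\<psi> ?w =
      sweedler s H a (\<lambda>a1 a2. sweedler s H a2 (\<lambda>a2 a3. \<beta> a1 a2 a3))"
    using s by (auto simp: lin_ext_tensor_lift lin_ext_tensor vector_space_scale_one
        tensor_lift_def[of s "comult H _"] case_prod_unfold intro!: tensor_lift_cong)
  finally show ?thesis .
qed

text \<open>
  An idempotent of the convolution algebra that has a right inverse is its neutral element:
  \<open>e = e * (e * e') = (e * e) * e' = e * e' = \<epsilon>\<close>.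
\<close>

lemma invertible_idempotent_functional:
  assumes lin: "linear_from (hbasis H) (*) e"
    and idem: "\<And>a. a \<in> hspace H \<Longrightarrow> sweedler (*) H a (\<lambda>a1 a2. e a1 * e a2) = e a"
    and inverse: "\<And>a. a \<in> hspace H \<Longrightarrow> sweedler (*) H a (\<lambda>a1 a2. e a1 * e' a2) = counit H a"
    and a: "a \<in> hspace H"
  shows "e a = counit H a"
proof -
  have "e a = sweedler (*) H a (\<lambda>a1 a2. e a1 * counit H a2)"
    by (subst counit_right[OF a, symmetric], subst linear_from_tensor_lift[OF lin])
      (use comult_keys[OF a] in \<open>auto intro!: fscale_mem_fspace tensor_lift_cong
        simp: linear_from_fscale[OF lin] simp del: fscale_single\<close>)
  also have "\<dots> = sweedler (*) H a (\<lambda>a1 a2. sweedler (*) H a2 (\<lambda>a2 a3. e a1 * (e a2 * e' a3)))"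
    using comult_keys[OF a]
    by (intro tensor_lift_cong)
      (simp add: inverse[symmetric] tensor_lift_def lin_ext_def sum_distrib_left case_prod_unfold
        mult.left_commute)
  also have "\<dots> = sweedler (*) H a (\<lambda>a1 a3. sweedler (*) H a1 (\<lambda>a1 a2. e a1 * (e a2 * e' a3)))"
    by (rule sweedler_coassoc[symmetric]) (simp_all add: a)
  also have "\<dots> = sweedler (*) H a (\<lambda>a1 a3. e a1 * e' a3)"
    using comult_keys[OF a]
    by (intro tensor_lift_cong, subst idem[symmetric])
      (simp_all add: tensor_lift_def lin_ext_def sum_distrib_right case_prod_unfold mult.assoc)
  also have "\<dots> = counit H a" by (rule inverse[OF a])
  finally show ?thesis .
qed

text \<open>
  The convolution inverse is \<open>R(S(a), b)\<close>, because \<open>\<Sum> R(a\<^sub>(\<^sub>1\<^sub>), b\<^sub>(\<^sub>1\<^sub>)) R(S(a\<^sub>(\<^sub>2\<^sub>)), b\<^sub>(\<^sub>2\<^sub>))\<close> equals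
  \<open>\<Sum> R(a\<^sub>(\<^sub>1\<^sub>) S(a\<^sub>(\<^sub>2\<^sub>)), b) = \<epsilon>(a) R(1, b)\<close>.
\<close>

lemma convolution_invertible_if_multiplicative:
  assumes R: "bilinear_form (hbasis H) R"
    and mult: "\<And>a b c. \<lbrakk>a \<in> hspace H; b \<in> hspace H; c \<in> hspace H\<rbrakk>
      \<Longrightarrow> R (hmult H a b) c = sweedler (*) H c (\<lambda>c1 c2. R a c1 * R b c2)"
    and unit: "\<And>b. b \<in> hspace H \<Longrightarrow> R (hunit H) b = counit H b"
  shows "convolution_invertible H R"
proof -
  let ?R' = "\<lambda>a b. R (antipode H a) b"
  have lin: "linear_from (hbasis H) (*) (\<lambda>v. R v w)" if "w \<in> hspace H" for w
    using R that by (simp add: bilinear_from_def)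
  have "bilinear_form (hbasis H) ?R'"
    using R antipode_closed linear_from_comp[OF lin antipode_linear]
    by (simp add: bilinear_from_def)
  moreover have "convolution H R ?R' a b = counit H a * counit H b"
    if a: "a \<in> hspace H" and b: "b \<in> hspace H" for a b
  proof -
    have "convolution H R ?R' a b = sweedler (*) H a (\<lambda>a1 a2. R (hmult H a1 (antipode H a2)) b)"
      unfolding convolution_def
      by (intro tensor_lift_cong) (simp add: mult comult_keys[OF a] antipode_closed b)
    also have "\<dots> = R (sweedler fscale H a (\<lambda>a1 a2. hmult H a1 (antipode H a2))) b"
      by (rule linear_from_tensor_lift[OF lin[OF b], symmetric])
        (simp add: comult_keys[OF a] mult_closed antipode_closed)
    finally show ?thesis
      using a b by (simp add: antipode_right linear_from_fscale[OF lin] unit_closed unit)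
  qed
  moreover have "convolution H ?R' R a b = counit H a * counit H b"
    if a: "a \<in> hspace H" and b: "b \<in> hspace H" for a b
  proof -
    have "convolution H ?R' R a b = sweedler (*) H a (\<lambda>a1 a2. R (hmult H (antipode H a1) a2) b)"
      unfolding convolution_def
      by (intro tensor_lift_cong) (simp add: mult comult_keys[OF a] antipode_closed b)
    also have "\<dots> = R (sweedler fscale H a (\<lambda>a1 a2. hmult H (antipode H a1) a2)) b"
      by (rule linear_from_tensor_lift[OF lin[OF b], symmetric])
        (simp add: comult_keys[OF a] mult_closed antipode_closed)
    finally show ?thesis
      using a b by (simp add: antipode_left linear_from_fscale[OF lin] unit_closed unit)
  qed
  ultimately show ?thesis
    unfolding convolution_invertible_def by blast
qed

end

context coquasitriangular
begin

lemma form_linear: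
  "w \<in> hspace H \<Longrightarrow> linear_from (hbasis H) (*) (\<lambda>v. R v w)"
  "w \<in> hspace H \<Longrightarrow> linear_from (hbasis H) (*) (\<lambda>v. R w v)"
  using form_bilinear by (auto simp: bilinear_from_def)

text \<open>
  Since \<open>1 1 = 1\<close> and \<open>1\<close> is group-like, \<open>R(\<cdot>, 1)\<close> and \<open>R(1, \<cdot>)\<close> are invertible idempotents of the
  convolution algebra.
\<close>

lemma form_unit:
  assumes a: "a \<in> hspace H"
  shows "R a (hunit H) = counit H a" and "R (hunit H) a = counit H a"
proof -
  obtain R' where R': "bilinear_form (hbasis H) R'"
    and inv: "\<And>a b. a \<in> hspace H \<Longrightarrow> b \<in> hspace H \<Longrightarrow>
      convolution H R R' a b = counit H a * counit H b"
    using form_invertible unfolding convolution_invertible_def by blast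
  note lin' = R'[unfolded bilinear_from_def]
  note u = unit_closed
  show "R a (hunit H) = counit H a"
  proof (rule invertible_idempotent_functional[where e' = "\<lambda>a. R' a (hunit H)", OF form_linear(1)[OF u] _ _ a])
    fix a assume a: "a \<in> hspace H"
    show "sweedler (*) H a (\<lambda>a1 a2. R a1 (hunit H) * R a2 (hunit H)) = R a (hunit H)"
      using form_mult_right[OF a u u] by (simp add: mult_unit_left u)
    have "sweedler (*) H a (\<lambda>a1 a2. R a1 (hunit H) * R' a2 (hunit H)) = convolution H R R' a (hunit H)"
      unfolding convolution_def comult_unit using comult_keys[OF a] u lin'
      by (intro tensor_lift_cong)
        (simp add: tensor_lift_tensor[where B = "hbasis H"] bilinear_from_mult form_linear)
    then show "sweedler (*) H a (\<lambda>a1 a2. R a1 (hunit H) * R' a2 (hunit H)) = counit H a"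
      using inv[OF a u] by (simp add: counit_unit)
  qed
  show "R (hunit H) a = counit H a"
  proof (rule invertible_idempotent_functional[where e' = "\<lambda>a. R' (hunit H) a", OF form_linear(2)[OF u] _ _ a])
    fix a assume a: "a \<in> hspace H"
    show "sweedler (*) H a (\<lambda>a1 a2. R (hunit H) a1 * R (hunit H) a2) = R (hunit H) a"
      using form_mult_left[OF u u a] by (simp add: mult_unit_left u)
    let ?\<beta> = "\<lambda>a1 a2. sweedler (*) H a (\<lambda>b1 b2. R a1 b1 * R' a2 b2)"
    have "bilinear_from (hbasis H) (*) ?\<beta>"
      unfolding bilinear_from_def using comult_keys[OF a] lin' form_linear
      by (auto intro!: linear_from_tensor_lift_param linear_from_scale_right linear_from_scale_left)
    then have "convolution H R R' (hunit H) a =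
        sweedler (*) H a (\<lambda>a1 a2. R (hunit H) a1 * R' (hunit H) a2)"
      unfolding convolution_def comult_unit by (simp add: tensor_lift_tensor[where B = "hbasis H"] u)
    then show "sweedler (*) H a (\<lambda>a1 a2. R (hunit H) a1 * R' (hunit H) a2) = counit H a"
      using inv[OF u a] by (simp add: counit_unit)
  qed
qed

end

section \<open>The bicrossed product is a Hopf algebra\<close>

context matched_pair
begin

lemma one_ract: "f \<in> carrier F \<Longrightarrow> \<one>\<^bsub>G\<^esub> \<triangleleft> f = \<one>\<^bsub>G\<^esub>"
  using ract_matched[of "\<one>\<^bsub>G\<^esub>" "\<one>\<^bsub>G\<^esub>" f] ract_closed[of "\<one>\<^bsub>G\<^esub>" f] by (simp add: lact_one)

lemma lact_Fone: "g \<in> carrier G \<Longrightarrow> g \<triangleright> \<one>\<^bsub>F\<^esub> = \<one>\<^bsub>F\<^esub>"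
  using lact_matched[of g "\<one>\<^bsub>F\<^esub>" "\<one>\<^bsub>F\<^esub>"] lact_closed[of g "\<one>\<^bsub>F\<^esub>"] by (simp add: ract_one)

lemma ract_inv_cancel:
  "g \<in> carrier G \<Longrightarrow> f \<in> carrier F \<Longrightarrow> g \<triangleleft> f \<triangleleft> inv\<^bsub>F\<^esub> f = g"
  "g \<in> carrier G \<Longrightarrow> f \<in> carrier F \<Longrightarrow> g \<triangleleft> inv\<^bsub>F\<^esub> f \<triangleleft> f = g"
  by (simp_all flip: ract_mult add: ract_one)

lemma ract_bij: "f \<in> carrier F \<Longrightarrow> bij_betw (\<lambda>g. g \<triangleleft> f) (carrier G) (carrier G)"
  by (rule bij_betw_byWitness[where f' = "\<lambda>g. g \<triangleleft> inv\<^bsub>F\<^esub> f"])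
    (auto simp: ract_inv_cancel ract_closed)

lemma inv_ract:
  assumes "g \<in> carrier G" "f \<in> carrier F"
  shows "inv\<^bsub>G\<^esub> (g \<triangleleft> f) = inv\<^bsub>G\<^esub> g \<triangleleft> (g \<triangleright> f)"
  using assms ract_matched[of "inv\<^bsub>G\<^esub> g" g f]
  by (intro G.inv_equality) (simp_all add: one_ract ract_closed lact_closed)

lemma inv_ract_ract_inv:
  assumes "g \<in> carrier G" "f \<in> carrier F"
  shows "inv\<^bsub>G\<^esub> (g \<triangleleft> f) \<triangleleft> inv\<^bsub>F\<^esub> (g \<triangleright> f) = inv\<^bsub>G\<^esub> g"
  using assms by (simp add: inv_ract ract_inv_cancel lact_closed)

lemma ract_quotient:
  assumes "g \<in> carrier G" "x \<in> carrier G" "f \<in> carrier F"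
  shows "(g \<otimes>\<^bsub>G\<^esub> inv\<^bsub>G\<^esub> x) \<triangleleft> (x \<triangleright> f) = (g \<triangleleft> f) \<otimes>\<^bsub>G\<^esub> inv\<^bsub>G\<^esub> (x \<triangleleft> f)"
  using assms ract_matched[of "g \<otimes>\<^bsub>G\<^esub> inv\<^bsub>G\<^esub> x" x f]
  by (simp add: ract_closed lact_closed G.m_assoc)

end

locale finite_bicrossed_product = matched_pair_cocycles G F ract lact \<sigma> \<tau>
  for G :: "('g, 'm) monoid_scheme" (structure) and F :: "('f, 'n) monoid_scheme"
    and ract :: "'g \<Rightarrow> 'f \<Rightarrow> 'g" (infixl "\<triangleleft>" 75)
    and lact :: "'g \<Rightarrow> 'f \<Rightarrow> 'f" (infixr "\<triangleright>" 75)
    and \<sigma> :: "'g \<Rightarrow> 'f \<Rightarrow> 'f \<Rightarrow> 'k::field"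
    and \<tau> :: "'g \<Rightarrow> 'g \<Rightarrow> 'f \<Rightarrow> 'k" +
  assumes finite_G: "finite (carrier G)"
begin

abbreviation H :: "('g \<times> 'f, 'k) hopf"
  where "H \<equiv> bicrossed_product G F ract lact \<sigma> \<tau>"

lemma hbasis_H [simp]: "hbasis H = carrier G \<times> carrier F"
  by (simp add: bicrossed_product_def)

lemma hunit_H: "hunit H = (\<Sum>g\<in>carrier G. g \<sharp> \<one>\<^bsub>F\<^esub>)"
  by (simp add: bicrossed_product_def)

text \<open>
  The structure maps are evaluated at multiples of basis vectors, so that nested expressions reduce to
  sums of such multiples by rewriting alone.
\<close>

lemma hmult_single:
  "hmult H (Poly_Mapping.single (g, f) c) (Poly_Mapping.single (g', f') c') =
    Poly_Mapping.single (g, f \<otimes>\<^bsub>F\<^esub> f') (c * c' * of_bool (g \<triangleleft> f = g') * \<sigma> g f f')"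
  by (simp add: bicrossed_product_def mult.assoc)

lemma comult_single:
  "comult H (Poly_Mapping.single (g, f) c) =
    (\<Sum>x\<in>carrier G. Poly_Mapping.single ((g \<otimes> inv x, x \<triangleright> f), (x, f)) (c * \<tau> (g \<otimes> inv x) x f))"
  by (simp add: bicrossed_product_def fscale_sum)

lemma counit_single: "counit H (Poly_Mapping.single (g, f) c) = c * of_bool (g = \<one>)"
  by (simp add: bicrossed_product_def)

lemma antipode_single:
  "antipode H (Poly_Mapping.single (g, f) c) =
    Poly_Mapping.single (inv (g \<triangleleft> f), inv\<^bsub>F\<^esub> (g \<triangleright> f))
      (c * (inverse (\<sigma> (inv g) (g \<triangleright> f) (inv\<^bsub>F\<^esub> (g \<triangleright> f))) * inverse (\<tau> (inv g) g f)))"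
  by (simp add: bicrossed_product_def)

lemma sweedler_single:
  "vector_space s \<Longrightarrow> sweedler s H (Poly_Mapping.single (g, f) c) \<beta> =
    (\<Sum>x\<in>carrier G. s (c * \<tau> (g \<otimes> inv x) x f) (\<beta> ((g \<otimes> inv x) \<sharp> (x \<triangleright> f)) (x \<sharp> f)))"
  by (simp add: comult_single tensor_lift_sum)

lemma linear_from_hmult_left:
  "linear_from B fscale \<phi> \<Longrightarrow> linear_from B fscale (\<lambda>v. hmult H (\<phi> v) w)"
  by (simp add: bicrossed_product_def linear_from_lin_ext_comp)

lemma linear_from_hmult_right:
  "linear_from B fscale \<phi> \<Longrightarrow> linear_from B fscale (\<lambda>v. hmult H w (\<phi> v))"
  by (simp add: bicrossed_product_def linear_from_lin_ext_comp linear_from_lin_ext_param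
      case_prod_unfold)

lemma linear_from_comult:
  "linear_from B fscale \<phi> \<Longrightarrow> linear_from B fscale (\<lambda>v. comult H (\<phi> v))"
  by (simp add: bicrossed_product_def linear_from_lin_ext_comp)

lemma linear_from_counit:
  "linear_from B fscale \<phi> \<Longrightarrow> linear_from B (*) (\<lambda>v. counit H (\<phi> v))"
  by (simp add: bicrossed_product_def linear_from_lin_ext_comp)

lemma linear_from_antipode:
  "linear_from B fscale \<phi> \<Longrightarrow> linear_from B fscale (\<lambda>v. antipode H (\<phi> v))"
  by (simp add: bicrossed_product_def linear_from_lin_ext_comp)

lemma linear_from_mult_const: "linear_from B (*) \<phi> \<Longrightarrow> linear_from B (*) (\<lambda>v. \<phi> v * c)"
  for c :: "'k"
  by (rule linear_from_scale_left) simp_all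

lemma linear_from_const_mult: "linear_from B (*) \<phi> \<Longrightarrow> linear_from B (*) (\<lambda>v. c * \<phi> v)"
  for c :: "'k"
  by (rule linear_from_scale_right) simp_all

lemmas linear_intros = vector_space_fscale vector_space_mult linear_from_id linear_from_hmult_left
  linear_from_hmult_right linear_from_comult linear_from_counit linear_from_antipode
  linear_from_tensor_lift_comp linear_from_tensor_lift_param linear_from_tensor_left
  linear_from_tensor_right linear_from_mult_const linear_from_const_mult
  linear_from_scale_left[OF vector_space_fscale]

lemma quotient_eq_one_iff:
  "g \<in> carrier G \<Longrightarrow> x \<in> carrier G \<Longrightarrow> g \<otimes> inv x = \<one> \<longleftrightarrow> x = g"
  using G.inv_equality[of g "inv x"] by auto

text \<open>
  Both sides sum \<open>\<phi> h v u\<close> over the factorizations \<open>g = h v u\<close>, split as \<open>(h v) u\<close> on the left and as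
  \<open>h (v u)\<close> on the right.
\<close>

lemma sum_coassoc:
  assumes "g \<in> carrier G"
  shows "(\<Sum>u\<in>carrier G. \<Sum>v\<in>carrier G. \<phi> (g \<otimes> inv u \<otimes> inv v) v u) =
    (\<Sum>w\<in>carrier G. \<Sum>u\<in>carrier G. \<phi> (g \<otimes> inv w) (w \<otimes> inv u) u)"
proof -
  have "(\<Sum>v\<in>carrier G. \<phi> (g \<otimes> inv u \<otimes> inv v) v u) =
      (\<Sum>w\<in>carrier G. \<phi> (g \<otimes> inv w) (w \<otimes> inv u) u)" if "u \<in> carrier G" for u
    using assms that
    by (intro sum.reindex_bij_witness[where i = "\<lambda>w. w \<otimes> inv u" and j = "\<lambda>v. v \<otimes> u"])
      (auto simp: G.m_assoc G.inv_mult_group)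
  then show ?thesis
    by (subst (2) sum.swap) simp
qed

lemma inv_mult_cancel:
  "a \<in> carrier G \<Longrightarrow> b \<in> carrier G \<Longrightarrow> a \<otimes> (inv a \<otimes> b) = b"
  "a \<in> carrier G \<Longrightarrow> b \<in> carrier G \<Longrightarrow> inv a \<otimes> (a \<otimes> b) = b"
  by (simp_all flip: G.m_assoc)

lemma quotient_eq_quotient_iff:
  assumes "a \<in> carrier G" "b \<in> carrier G" "c \<in> carrier G" "x \<in> carrier G"
  shows "a \<otimes> inv b = c \<otimes> inv x \<longleftrightarrow> x = b \<otimes> inv a \<otimes> c"
proof
  assume "a \<otimes> inv b = c \<otimes> inv x"
  then have "inv (a \<otimes> inv b) = inv (c \<otimes> inv x)" by simp
  then show "x = b \<otimes> inv a \<otimes> c"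
    using assms by (simp add: G.inv_mult_group G.m_assoc)
qed (use assms in \<open>simp add: G.inv_mult_group G.m_assoc inv_mult_cancel\<close>)

text \<open>
  The coefficient of the factorization \<open>g = h v u\<close> is a product of two values of \<open>\<tau>\<close> on either side;
  these products agree by the cocycle identity at \<open>(h, v, u; f)\<close>.
\<close>

lemma comult_coassoc_basis:
  assumes p: "g \<in> carrier G" "f \<in> carrier F"
  shows "Poly_Mapping.lookup
      (sweedler fscale H (g \<sharp> f) (\<lambda>a1 a2. tensor (comult H a1) a2)) ((x, y), z) =
    Poly_Mapping.lookup
      (sweedler fscale H (g \<sharp> f) (\<lambda>a1 a2. tensor a1 (comult H a2))) (x, (y, z))"
proof -
  note [simp] = ract_closed lact_closed
  let ?\<phi> = "\<lambda>h v u. Poly_Mapping.lookup (Poly_Mapping.single (((h, (v \<otimes> u) \<triangleright> f), (v, u \<triangleright> f)), (u, f))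
      (\<tau> h (v \<otimes> u) f * \<tau> v u f)) ((x, y), z)"
  have "Poly_Mapping.lookup (sweedler fscale H (g \<sharp> f)
        (\<lambda>a1 a2. tensor (comult H a1) a2)) ((x, y), z) =
      (\<Sum>u\<in>carrier G. \<Sum>v\<in>carrier G. ?\<phi> (g \<otimes> inv u \<otimes> inv v) v u)"
  proof -
    have "\<tau> (g \<otimes> inv u) u f * \<tau> (g \<otimes> inv u \<otimes> inv v) v (u \<triangleright> f) =
        \<tau> (g \<otimes> inv u \<otimes> inv v) (v \<otimes> u) f * \<tau> v u f"
      if "u \<in> carrier G" "v \<in> carrier G" for u v
      using \<tau>_cocycle[of "g \<otimes> inv u \<otimes> inv v" v u f] p that by (simp add: G.m_assoc mult.commute)
    then show ?thesis
      using p by (simp add: tensor_lift_sum comult_single tensor_sum_left fscale_sum lookup_sum lact_mult)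
  qed
  also have "\<dots> = (\<Sum>w\<in>carrier G. \<Sum>u\<in>carrier G. ?\<phi> (g \<otimes> inv w) (w \<otimes> inv u) u)"
    by (rule sum_coassoc) (rule p)
  also have "\<dots> = Poly_Mapping.lookup (sweedler fscale H (g \<sharp> f)
        (\<lambda>a1 a2. tensor a1 (comult H a2))) (x, (y, z))"
    using p by (simp add: tensor_lift_sum comult_single tensor_sum_right fscale_sum lookup_sum
        G.m_assoc, intro sum.cong refl) (auto simp: lookup_single when_def)
  finally show ?thesis .
qed

text \<open>
  When the summands of the two comultiplications indexed by \<open>x\<close> and \<open>y\<close> are multiplied, the second
  tensor factor forces \<open>y = x \<triangleleft> f\<close>. The condition from the first factor then amounts to \<open>g \<triangleleft> f = g'\<close>, and the
  scalars agree by the compatibility of \<open>\<sigma>\<close> and \<open>\<tau>\<close>.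
\<close>

lemma comult_mult_basis:
  assumes p: "g \<in> carrier G" "f \<in> carrier F" and q: "g' \<in> carrier G" "f' \<in> carrier F"
  shows "comult H (hmult H (g \<sharp> f) (g' \<sharp> f')) =
    sweedler fscale H (g \<sharp> f) (\<lambda>a1 a2. sweedler fscale H (g' \<sharp> f') (\<lambda>b1 b2.
      tensor (hmult H a1 b1) (hmult H a2 b2)))"
proof -
  note [simp] = ract_closed lact_closed
  have "(\<Sum>y\<in>carrier G. Poly_Mapping.single
        ((g \<otimes> inv x, x \<triangleright> f \<otimes>\<^bsub>F\<^esub> y \<triangleright> f'), x, f \<otimes>\<^bsub>F\<^esub> f')
        (\<tau> (g \<otimes> inv x) x f * (\<tau> (g' \<otimes> inv y) y f' *
          (of_bool ((g \<otimes> inv x) \<triangleleft> (x \<triangleright> f) = g' \<otimes> inv y) * \<sigma> (g \<otimes> inv x) (x \<triangleright> f) (y \<triangleright> f') *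
           (of_bool (x \<triangleleft> f = y) * \<sigma> x f f'))))) =
      Poly_Mapping.single ((g \<otimes> inv x, x \<triangleright> (f \<otimes>\<^bsub>F\<^esub> f')), x, f \<otimes>\<^bsub>F\<^esub> f')
        (of_bool (g \<triangleleft> f = g') * \<sigma> g f f' * \<tau> (g \<otimes> inv x) x (f \<otimes>\<^bsub>F\<^esub> f'))"
    if x: "x \<in> carrier G" for x
  proof -
    have "(g \<otimes> inv x) \<triangleleft> (x \<triangleright> f) = g' \<otimes> inv (x \<triangleleft> f) \<longleftrightarrow> g \<triangleleft> f = g'"
      using x p q by (simp add: ract_quotient)
    moreover have "\<sigma> g f f' * \<tau> (g \<otimes> inv x) x (f \<otimes>\<^bsub>F\<^esub> f') = \<sigma> (g \<otimes> inv x) (x \<triangleright> f) ((x \<triangleleft> f) \<triangleright> f') *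
        \<sigma> x f f' * \<tau> (g \<otimes> inv x) x f * \<tau> ((g \<otimes> inv x) \<triangleleft> (x \<triangleright> f)) (x \<triangleleft> f) f'"
      using x p q \<sigma>_\<tau>_compatible[of "g \<otimes> inv x" x f f'] by (simp add: G.m_assoc)
    ultimately show ?thesis
      using x p q finite_G by (subst sum_eq_single_term[where a = "x \<triangleleft> f"])
        (auto simp: lact_matched ract_quotient mult_ac)
  qed
  then show ?thesis
    using p q by (simp add: hmult_single comult_single tensor_lift_sum fscale_sum)
qed

text \<open>
  The product in the \<open>x\<close>-th summand is nonzero only if \<open>x g\<^sup>-\<^sup>1 = x\<close>, that is, if \<open>g = 1\<close>. For
  \<open>g = 1\<close> the cocycle identities, evaluated at \<open>(x; f, f\<^sup>-\<^sup>1, f)\<close> and \<open>(x, x\<^sup>-\<^sup>1, x; f)\<close>, show that its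
  scalar is \<open>1\<close>, and the idempotents are permuted by the bijection \<open>x \<mapsto> x \<triangleleft> f\<close>.
\<close>

lemma antipode_left_basis:
  assumes p: "g \<in> carrier G" "f \<in> carrier F"
  shows "sweedler fscale H (g \<sharp> f) (\<lambda>a1 a2. hmult H (antipode H a1) a2) =
    fscale (counit H (g \<sharp> f)) (hunit H)"
proof -
  note [simp] = ract_closed lact_closed
  have "\<tau> (g \<otimes> inv x) x f *
      (inverse (\<sigma> (inv (g \<otimes> inv x)) (g \<triangleright> f) (inv\<^bsub>F\<^esub> (g \<triangleright> f))) *
       inverse (\<tau> (inv (g \<otimes> inv x)) (g \<otimes> inv x) (x \<triangleright> f)) *
       of_bool (inv ((g \<otimes> inv x) \<triangleleft> (x \<triangleright> f)) \<triangleleft> inv\<^bsub>F\<^esub> (g \<triangleright> f) = x) *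
       \<sigma> (inv ((g \<otimes> inv x) \<triangleleft> (x \<triangleright> f))) (inv\<^bsub>F\<^esub> (g \<triangleright> f)) f) = of_bool (g = \<one>)"
    if x: "x \<in> carrier G" for x
  proof -
    let ?u = "g \<otimes> inv x"
    have ux: "?u \<triangleright> x \<triangleright> f = g \<triangleright> f"
      using p x by (simp flip: lact_mult add: G.m_assoc)
    have "inv (?u \<triangleleft> (x \<triangleright> f)) \<triangleleft> inv\<^bsub>F\<^esub> (g \<triangleright> f) = inv ?u"
      using inv_ract_ract_inv[of ?u "x \<triangleright> f"] p x by (simp add: ux)
    moreover have "inv ?u = x \<longleftrightarrow> g = \<one>"
      using p x by (metis G.inv_closed G.inv_inv G.inv_solve_right G.l_one G.r_inv G.m_closed quotient_eq_one_iff G.one_closed)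
    moreover have ?thesis if "g = \<one>"
    proof -
      have "\<sigma> (x \<triangleleft> f) (inv\<^bsub>F\<^esub> f) f = \<sigma> x f (inv\<^bsub>F\<^esub> f)"
        using \<sigma>_cocycle[of x f "inv\<^bsub>F\<^esub> f" f] p x by (simp add: \<sigma>_one_left \<sigma>_one_right)
      moreover have "\<tau> x (inv x) (x \<triangleright> f) = \<tau> (inv x) x f"
        using \<tau>_cocycle[of x "inv x" x f] p x by (simp add: \<tau>_one_left \<tau>_one_right)
      moreover have "inv (inv x \<triangleleft> (x \<triangleright> f)) = x \<triangleleft> f"
        using p x inv_ract[of x f] by (metis G.inv_inv ract_closed)
      ultimately show ?thesis
        using p x that \<sigma>_nonzero[of x f "inv\<^bsub>F\<^esub> f"] \<tau>_nonzero[of "inv x" x f]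
        by (simp add: lact_one ract_inv_cancel field_simps)
    qed
    ultimately show ?thesis by (auto simp: mult.assoc)
  qed
  then have "sweedler fscale H (g \<sharp> f) (\<lambda>a1 a2. hmult H (antipode H a1) a2) =
      (\<Sum>x\<in>carrier G. Poly_Mapping.single (inv ((g \<otimes> inv x) \<triangleleft> (x \<triangleright> f)),
        inv\<^bsub>F\<^esub> (g \<triangleright> f) \<otimes>\<^bsub>F\<^esub> f) (of_bool (g = \<one>)))"
    using p by (simp add: sweedler_single hmult_single antipode_single G.m_assoc
        flip: lact_mult)
  also have "\<dots> = (\<Sum>x\<in>carrier G. Poly_Mapping.single (x \<triangleleft> f, \<one>\<^bsub>F\<^esub>) (of_bool (g = \<one>)))"
  proof (cases "g = \<one>")
    case True
    have "inv (inv x \<triangleleft> (x \<triangleright> f)) = x \<triangleleft> f" if "x \<in> carrier G" for x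
      using p that inv_ract[of x f] by (metis G.inv_inv ract_closed)
    with True p show ?thesis by (simp add: lact_one)
  qed simp
  also have "\<dots> = (\<Sum>x\<in>carrier G. Poly_Mapping.single (x, \<one>\<^bsub>F\<^esub>) (of_bool (g = \<one>)))"
    using p by (intro sum.reindex_bij_betw[OF ract_bij])
  also have "\<dots> = fscale (counit H (g \<sharp> f)) (hunit H)"
    using p by (simp add: counit_single hunit_H fscale_sum)
  finally show ?thesis .
qed

text \<open>
  Again only \<open>g = 1\<close> contributes. The scalars of \<open>S(p\<^sub>x # f)\<close> are the inverses of the remaining ones.
\<close>

lemma antipode_right_basis:
  assumes p: "g \<in> carrier G" "f \<in> carrier F"
  shows "sweedler fscale H (g \<sharp> f) (\<lambda>a1 a2. hmult H a1 (antipode H a2)) =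
    fscale (counit H (g \<sharp> f)) (hunit H)"
proof -
  note [simp] = ract_closed lact_closed
  have "\<tau> (g \<otimes> inv x) x f *
      (inverse (\<sigma> (inv x) (x \<triangleright> f) (inv\<^bsub>F\<^esub> (x \<triangleright> f))) * inverse (\<tau> (inv x) x f) *
       of_bool ((g \<otimes> inv x) \<triangleleft> (x \<triangleright> f) = inv (x \<triangleleft> f)) *
       \<sigma> (g \<otimes> inv x) (x \<triangleright> f) (inv\<^bsub>F\<^esub> (x \<triangleright> f))) = of_bool (g = \<one>)"
    if x: "x \<in> carrier G" for x
  proof -
    have "(g \<otimes> inv x) \<triangleleft> (x \<triangleright> f) = inv (x \<triangleleft> f) \<longleftrightarrow> g \<triangleleft> f = \<one>"
      using p x by (simp add: ract_quotient)
    also have "\<dots> \<longleftrightarrow> g = \<one>"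
      using p by (metis one_ract ract_inv_cancel(1) F.inv_closed)
    finally show ?thesis
      using p x \<sigma>_nonzero[of "inv x" "x \<triangleright> f" "inv\<^bsub>F\<^esub> (x \<triangleright> f)"] \<tau>_nonzero[of "inv x" x f]
      by (auto simp: field_simps)
  qed
  then have "sweedler fscale H (g \<sharp> f) (\<lambda>a1 a2. hmult H a1 (antipode H a2)) =
      (\<Sum>x\<in>carrier G. Poly_Mapping.single (g \<otimes> inv x, \<one>\<^bsub>F\<^esub>) (of_bool (g = \<one>)))"
    using p by (simp add: sweedler_single hmult_single antipode_single)
  also have "\<dots> = (\<Sum>x\<in>carrier G. Poly_Mapping.single (x, \<one>\<^bsub>F\<^esub>) (of_bool (g = \<one>)))"
    using p by (intro sum.reindex_bij_witness[where i = "\<lambda>x. inv x \<otimes> g" and j = "\<lambda>x. g \<otimes> inv x"])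
      (auto simp: G.m_assoc G.inv_mult_group inv_mult_cancel)
  also have "\<dots> = fscale (counit H (g \<sharp> f)) (hunit H)"
    using p by (simp add: counit_single hunit_H fscale_sum)
  finally show ?thesis .
qed

lemma hopf_algebra_H: "hopf_algebra H"
proof
  note [simp] = ract_closed lact_closed
  show "bilinear_from (hbasis H) fscale (hmult H)"
    by (auto simp: bilinear_from_def intro!: linear_intros)
  show "linear_from (hbasis H) fscale (comult H)" "linear_from (hbasis H) (*) (counit H)"
    "linear_from (hbasis H) fscale (antipode H)"
    using linear_from_comult[OF linear_from_id] linear_from_counit[OF linear_from_id]
      linear_from_antipode[OF linear_from_id] by auto
  show "hunit H \<in> hspace H"
    by (auto simp: hunit_H intro!: sum_mem_fspace)
  show "hmult H a b \<in> hspace H" if "a \<in> hspace H" "b \<in> hspace H" for a b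
    using that unfolding bicrossed_product_def
    by (auto intro!: lin_ext_mem_fspace fscale_mem_fspace single_mem_fspace simp: case_prod_unfold
        dest!: fspaceD)
  show "comult H a \<in> fspace (hbasis H \<times> hbasis H)" if "a \<in> hspace H" for a
    using that unfolding bicrossed_product_def
    by (auto intro!: lin_ext_mem_fspace fscale_mem_fspace sum_mem_fspace single_mem_fspace
        simp: case_prod_unfold dest!: fspaceD)
  show "antipode H a \<in> hspace H" if "a \<in> hspace H" for a
    using that unfolding bicrossed_product_def
    by (auto intro!: lin_ext_mem_fspace fscale_mem_fspace single_mem_fspace
        simp: case_prod_unfold dest!: fspaceD)
  show "hmult H (hmult H a b) c = hmult H a (hmult H b c)"
    if "a \<in> hspace H" "b \<in> hspace H" "c \<in> hspace H" for a b c
  proof (rule trilinear_eqI[where B = "hbasis H" and s = fscale, OF _ _ _ _ _ that])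
    fix p q r assume "p \<in> hbasis H" "q \<in> hbasis H" "r \<in> hbasis H"
    then show "hmult H (hmult H (Poly_Mapping.single p 1) (Poly_Mapping.single q 1)) (Poly_Mapping.single r 1) =
      hmult H (Poly_Mapping.single p 1) (hmult H (Poly_Mapping.single q 1) (Poly_Mapping.single r 1))"
      by (auto simp: hmult_single ract_mult F.m_assoc of_bool_def \<sigma>_cocycle algebra_simps)
  qed (auto simp: bilinear_from_def intro!: linear_intros)
  show "hmult H (hunit H) a = a" if "a \<in> hspace H" for a
  proof (rule linear_from_eqI[where B = "hbasis H" and s = fscale, OF _ _ _ that])
    fix p assume "p \<in> hbasis H"
    then obtain g f where p: "p = (g, f)" "g \<in> carrier G" "f \<in> carrier F" by auto
    have "hmult H (hunit H) (Poly_Mapping.single p 1) =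
        (\<Sum>x\<in>carrier G. hmult H (x \<sharp> \<one>\<^bsub>F\<^esub>) (g \<sharp> f))"
      unfolding hunit_H p by (rule linear_from_sum[where B = UNIV and s = fscale])
        (auto intro!: linear_intros simp: fspace_def)
    also have "\<dots> = Poly_Mapping.single p 1"
      using p finite_G by (subst sum_eq_single_term[where a = g])
        (auto simp: hmult_single ract_one \<sigma>_one_left)
    finally show "hmult H (hunit H) (Poly_Mapping.single p 1) = Poly_Mapping.single p 1" .
  qed (auto intro!: linear_intros)
  show "hmult H a (hunit H) = a" if "a \<in> hspace H" for a
  proof (rule linear_from_eqI[where B = "hbasis H" and s = fscale, OF _ _ _ that])
    fix p assume "p \<in> hbasis H"
    then obtain g f where p: "p = (g, f)" "g \<in> carrier G" "f \<in> carrier F" by auto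
    have "hmult H (Poly_Mapping.single p 1) (hunit H) =
        (\<Sum>x\<in>carrier G. hmult H (g \<sharp> f) (x \<sharp> \<one>\<^bsub>F\<^esub>))"
      unfolding hunit_H p by (rule linear_from_sum[where B = UNIV and s = fscale])
        (auto intro!: linear_intros simp: fspace_def)
    also have "\<dots> = Poly_Mapping.single p 1"
      using p finite_G by (subst sum_eq_single_term[where a = "g \<triangleleft> f"])
        (auto simp: hmult_single \<sigma>_one_right)
    finally show "hmult H (Poly_Mapping.single p 1) (hunit H) = Poly_Mapping.single p 1" .
  qed (auto intro!: linear_intros)
  show "Poly_Mapping.lookup
             (sweedler fscale H a (\<lambda>a1 a2. tensor (comult H a1) a2)) ((x, y), z) =
           Poly_Mapping.lookup
             (sweedler fscale H a (\<lambda>a1 a2. tensor a1 (comult H a2))) (x, (y, z))"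
    if "a \<in> hspace H" for a x y z
  proof (rule linear_from_eqI[where B = "hbasis H" and s = "(*)", OF _ _ _ that])
    fix p assume "p \<in> hbasis H"
    then show "Poly_Mapping.lookup (sweedler fscale H (Poly_Mapping.single p 1)
          (\<lambda>a1 a2. tensor (comult H a1) a2)) ((x, y), z) =
        Poly_Mapping.lookup (sweedler fscale H (Poly_Mapping.single p 1)
          (\<lambda>a1 a2. tensor a1 (comult H a2))) (x, (y, z))"
      by (auto simp: comult_coassoc_basis)
  qed (auto intro!: linear_from_lookup linear_intros)
  show "sweedler fscale H a (\<lambda>a1 a2. fscale (counit H a1) a2) = a" if "a \<in> hspace H" for a
  proof (rule linear_from_eqI[where B = "hbasis H" and s = fscale, OF _ _ _ that])
    fix p assume "p \<in> hbasis H"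
    then obtain g f where p: "p = (g, f)" "g \<in> carrier G" "f \<in> carrier F" by auto
    then show "sweedler fscale H (Poly_Mapping.single p 1) (\<lambda>a1 a2. fscale (counit H a1) a2) =
        Poly_Mapping.single p 1"
      using finite_G by (simp add: sweedler_single, subst sum_eq_single_term[where a = g])
        (auto simp: counit_single quotient_eq_one_iff \<tau>_one_left)
  qed (auto intro!: linear_intros)
  show "sweedler fscale H a (\<lambda>a1 a2. fscale (counit H a2) a1) = a" if "a \<in> hspace H" for a
  proof (rule linear_from_eqI[where B = "hbasis H" and s = fscale, OF _ _ _ that])
    fix p assume "p \<in> hbasis H"
    then obtain g f where p: "p = (g, f)" "g \<in> carrier G" "f \<in> carrier F" by auto
    then show "sweedler fscale H (Poly_Mapping.single p 1) (\<lambda>a1 a2. fscale (counit H a2) a1) =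
        Poly_Mapping.single p 1"
      using finite_G by (simp add: sweedler_single, subst sum_eq_single_term[where a = \<one>])
        (auto simp: counit_single \<tau>_one_right lact_one)
  qed (auto intro!: linear_intros)
  show "comult H (hmult H a b) = sweedler fscale H a (\<lambda>a1 a2. sweedler fscale H b (\<lambda>b1 b2.
             tensor (hmult H a1 b1) (hmult H a2 b2)))"
    if "a \<in> hspace H" "b \<in> hspace H" for a b
  proof (rule bilinear_eqI[where B = "hbasis H" and s = fscale, OF _ _ _ that])
    fix p q assume "p \<in> hbasis H" "q \<in> hbasis H"
    then show "comult H (hmult H (Poly_Mapping.single p 1) (Poly_Mapping.single q 1)) =
        sweedler fscale H (Poly_Mapping.single p 1) (\<lambda>a1 a2.
          sweedler fscale H (Poly_Mapping.single q 1) (\<lambda>b1 b2.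
            tensor (hmult H a1 b1) (hmult H a2 b2)))"
      by (auto simp: comult_mult_basis)
  qed (auto simp: bilinear_from_def intro!: linear_intros)
  show "comult H (hunit H) = tensor (hunit H) (hunit H)"
  proof -
    have "comult H (hunit H) = (\<Sum>g\<in>carrier G. comult H (g \<sharp> \<one>\<^bsub>F\<^esub>))"
      unfolding hunit_H by (rule linear_from_sum[where B = UNIV and s = fscale])
        (auto intro!: linear_intros simp: fspace_def)
    also have "\<dots> = (\<Sum>x\<in>carrier G. \<Sum>g\<in>carrier G.
        Poly_Mapping.single ((g \<otimes> inv x, \<one>\<^bsub>F\<^esub>), (x, \<one>\<^bsub>F\<^esub>)) 1)"
      unfolding comult_single by (subst sum.swap) (simp add: lact_Fone \<tau>_one)
    also have "\<dots> = (\<Sum>x\<in>carrier G. \<Sum>g\<in>carrier G. Poly_Mapping.single ((g, \<one>\<^bsub>F\<^esub>), (x, \<one>\<^bsub>F\<^esub>)) 1)"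
      by (intro sum.cong refl sum.reindex_bij_witness[where i = "\<lambda>g. g \<otimes> x" and j = "\<lambda>g. g \<otimes> inv x" for x])
        (auto simp: G.m_assoc)
    also have "\<dots> = tensor (hunit H) (hunit H)"
      by (simp add: hunit_H tensor_sum_left tensor_sum_right)
    finally show ?thesis .
  qed
  show "counit H (hmult H a b) = counit H a * counit H b"
    if "a \<in> hspace H" "b \<in> hspace H" for a b
  proof (rule bilinear_eqI[where B = "hbasis H" and s = "(*)", OF _ _ _ that])
    fix p q assume "p \<in> hbasis H" "q \<in> hbasis H"
    then show "counit H (hmult H (Poly_Mapping.single p 1) (Poly_Mapping.single q 1)) =
        counit H (Poly_Mapping.single p 1) * counit H (Poly_Mapping.single q 1)"
      by (auto simp: hmult_single counit_single one_ract \<sigma>_one)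
  qed (auto simp: bilinear_from_def intro!: linear_intros)
  show "counit H (hunit H) = 1"
  proof -
    have "counit H (hunit H) = (\<Sum>g\<in>carrier G. counit H (g \<sharp> \<one>\<^bsub>F\<^esub>))"
      unfolding hunit_H by (rule linear_from_sum[where B = UNIV and s = "(*)"])
        (auto intro!: linear_intros simp: fspace_def)
    then show ?thesis
      using finite_G by (simp add: counit_single sum.If_cases sum_eq_single_term[where a = \<one>])
  qed
  show "sweedler fscale H a (\<lambda>a1 a2. hmult H (antipode H a1) a2) = fscale (counit H a) (hunit H)"
    if "a \<in> hspace H" for a
  proof (rule linear_from_eqI[where B = "hbasis H" and s = fscale, OF _ _ _ that])
    fix p assume "p \<in> hbasis H"
    then show "sweedler fscale H (Poly_Mapping.single p 1) (\<lambda>a1 a2. hmult H (antipode H a1) a2) =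
        fscale (counit H (Poly_Mapping.single p 1)) (hunit H)"
      by (auto simp: antipode_left_basis)
  qed (auto intro!: linear_intros)
  show "sweedler fscale H a (\<lambda>a1 a2. hmult H a1 (antipode H a2)) = fscale (counit H a) (hunit H)"
    if "a \<in> hspace H" for a
  proof (rule linear_from_eqI[where B = "hbasis H" and s = fscale, OF _ _ _ that])
    fix p assume "p \<in> hbasis H"
    then show "sweedler fscale H (Poly_Mapping.single p 1) (\<lambda>a1 a2. hmult H a1 (antipode H a2)) =
        fscale (counit H (Poly_Mapping.single p 1)) (hunit H)"
      by (auto simp: antipode_right_basis)
  qed (auto intro!: linear_intros)
qed

section \<open>Coquasitriangular structures on the bicrossed product\<close>

context
  fixes R :: "('g \<times> 'f \<Rightarrow>\<^sub>0 'k) \<Rightarrow> ('g \<times> 'f \<Rightarrow>\<^sub>0 'k) \<Rightarrow> 'k"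
  assumes R: "bilinear_form (carrier G \<times> carrier F) R"
begin

interpretation hopf_algebra H by (rule hopf_algebra_H)

lemma linear_from_form_left:
  "\<lbrakk>linear_from (carrier G \<times> carrier F) fscale \<phi>; \<And>v. v \<in> hspace H \<Longrightarrow> \<phi> v \<in> hspace H; w \<in> hspace H\<rbrakk>
    \<Longrightarrow> linear_from (carrier G \<times> carrier F) (*) (\<lambda>v. R (\<phi> v) w)"
  by (rule linear_from_comp[of "carrier G \<times> carrier F" "(*)" "\<lambda>v. R v w"])
    (use R in \<open>auto simp: bilinear_from_def\<close>)

lemma linear_from_form_right:
  "\<lbrakk>linear_from (carrier G \<times> carrier F) fscale \<phi>; \<And>v. v \<in> hspace H \<Longrightarrow> \<phi> v \<in> hspace H; w \<in> hspace H\<rbrakk>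
    \<Longrightarrow> linear_from (carrier G \<times> carrier F) (*) (\<lambda>v. R w (\<phi> v))"
  by (rule linear_from_comp[of "carrier G \<times> carrier F" "(*)" "R w"])
    (use R in \<open>auto simp: bilinear_from_def\<close>)

lemma form_single:
  assumes "p \<in> carrier G \<times> carrier F" "v \<in> hspace H"
  shows "R (Poly_Mapping.single p c) v = c * R (Poly_Mapping.single p 1) v"
    and "R v (Poly_Mapping.single p c) = c * R v (Poly_Mapping.single p 1)"
  using linear_from_fscale[OF linear_from_form_left[OF linear_from_id], of v "Poly_Mapping.single p 1" c]
    linear_from_fscale[OF linear_from_form_right[OF linear_from_id], of v "Poly_Mapping.single p 1" c] assms
  by simp_all

lemma comult_basis_mem:
  assumes "(b, c) \<in> Poly_Mapping.keys (comult H a)" "a \<in> fspace (carrier G \<times> carrier F)"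
  shows "Poly_Mapping.single b (1::'k) \<in> fspace (carrier G \<times> carrier F) \<and>
    Poly_Mapping.single c (1::'k) \<in> fspace (carrier G \<times> carrier F)"
  using comult_keys[of a b c] assms by simp

lemma CQT0_iff:
  "CQT0 G F R \<longleftrightarrow> (\<forall>a\<in>hspace H. R (hunit H) a = counit H a \<and> R a (hunit H) = counit H a)"
proof -
  let ?B = "carrier G \<times> carrier F"
  have left: "R (hunit H) a = (\<Sum>x\<in>carrier G. R (x \<sharp> \<one>\<^bsub>F\<^esub>) a)" if "a \<in> hspace H" for a
    unfolding hunit_H using that
    by (intro linear_from_sum[OF linear_from_form_left[OF linear_from_id]]) auto
  have right: "R a (hunit H) = (\<Sum>x\<in>carrier G. R a (x \<sharp> \<one>\<^bsub>F\<^esub>))" if "a \<in> hspace H" for a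
    unfolding hunit_H using that
    by (intro linear_from_sum[OF linear_from_form_right[OF linear_from_id]]) auto
  have "CQT0 G F R \<longleftrightarrow> (\<forall>p\<in>?B. R (hunit H) (Poly_Mapping.single p 1) = counit H (Poly_Mapping.single p 1) \<and>
      R (Poly_Mapping.single p 1) (hunit H) = counit H (Poly_Mapping.single p 1))"
    by (auto simp: CQT0_def left right counit_single)
  also have "\<dots> \<longleftrightarrow> (\<forall>a\<in>hspace H. R (hunit H) a = counit H a \<and> R a (hunit H) = counit H a)"
  proof safe
    fix a assume *: "\<forall>p\<in>?B. R (hunit H) (Poly_Mapping.single p 1) = counit H (Poly_Mapping.single p 1) \<and>
      R (Poly_Mapping.single p 1) (hunit H) = counit H (Poly_Mapping.single p 1)" and a: "a \<in> hspace H"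
    show "R (hunit H) a = counit H a"
      by (rule linear_from_eqI[where B = ?B and s = "(*)" and v = a])
        (use * a unit_closed in \<open>auto intro!: linear_intros linear_from_form_right\<close>)
    show "R a (hunit H) = counit H a"
      by (rule linear_from_eqI[where B = ?B and s = "(*)" and v = a])
        (use * a unit_closed in \<open>auto intro!: linear_intros linear_from_form_left\<close>)
  qed auto
  finally show ?thesis .
qed

lemma CQT1_iff:
  "CQT1 G F ract lact \<sigma> \<tau> R \<longleftrightarrow> (\<forall>a\<in>hspace H. \<forall>b\<in>hspace H. \<forall>c\<in>hspace H.
    R a (hmult H b c) = sweedler (*) H a (\<lambda>a1 a2. R a1 c * R a2 b))"
proof -
  let ?B = "carrier G \<times> carrier F"
  let ?e = "\<lambda>p. Poly_Mapping.single p 1"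
  have "CQT1 G F ract lact \<sigma> \<tau> R \<longleftrightarrow> (\<forall>p\<in>?B. \<forall>q\<in>?B. \<forall>r\<in>?B.
      R (?e p) (hmult H (?e q) (?e r)) = sweedler (*) H (?e p) (\<lambda>a1 a2. R a1 (?e r) * R a2 (?e q)))"
    unfolding CQT1_def
    by (simp add: sweedler_single hmult_single form_single(2)[where c = "_ * _"] mult.assoc) blast
  also have "\<dots> \<longleftrightarrow> (\<forall>a\<in>hspace H. \<forall>b\<in>hspace H. \<forall>c\<in>hspace H.
    R a (hmult H b c) = sweedler (*) H a (\<lambda>a1 a2. R a1 c * R a2 b))"
  proof (intro iffI ballI)
    fix a b c assume *: "\<forall>p\<in>?B. \<forall>q\<in>?B. \<forall>r\<in>?B.
      R (?e p) (hmult H (?e q) (?e r)) = sweedler (*) H (?e p) (\<lambda>a1 a2. R a1 (?e r) * R a2 (?e q))"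
      and a: "a \<in> hspace H" "b \<in> hspace H" "c \<in> hspace H"
    show "R a (hmult H b c) = sweedler (*) H a (\<lambda>a1 a2. R a1 c * R a2 b)"
      by (rule trilinear_eqI[where B = ?B and s = "(*)" and v = a and w = b and u = c])
        (use * a mult_closed in \<open>auto simp: bilinear_from_def
          intro!: linear_intros linear_from_form_left linear_from_form_right dest!: comult_basis_mem\<close>)
  qed auto
  finally show ?thesis .
qed

lemma CQT2_iff:
  "CQT2 G F ract lact \<sigma> \<tau> R \<longleftrightarrow> (\<forall>a\<in>hspace H. \<forall>b\<in>hspace H. \<forall>c\<in>hspace H.
    R (hmult H a b) c = sweedler (*) H c (\<lambda>c1 c2. R a c1 * R b c2))"
proof -
  let ?B = "carrier G \<times> carrier F"
  let ?e = "\<lambda>p. Poly_Mapping.single p 1"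
  have "CQT2 G F ract lact \<sigma> \<tau> R \<longleftrightarrow> (\<forall>p\<in>?B. \<forall>q\<in>?B. \<forall>r\<in>?B.
      R (hmult H (?e p) (?e q)) (?e r) = sweedler (*) H (?e r) (\<lambda>c1 c2. R (?e p) c1 * R (?e q) c2))"
    unfolding CQT2_def
    by (simp add: sweedler_single hmult_single form_single(1)[where c = "_ * _"] mult.assoc) blast
  also have "\<dots> \<longleftrightarrow> (\<forall>a\<in>hspace H. \<forall>b\<in>hspace H. \<forall>c\<in>hspace H.
    R (hmult H a b) c = sweedler (*) H c (\<lambda>c1 c2. R a c1 * R b c2))"
  proof (intro iffI ballI)
    fix a b c assume *: "\<forall>p\<in>?B. \<forall>q\<in>?B. \<forall>r\<in>?B.
      R (hmult H (?e p) (?e q)) (?e r) = sweedler (*) H (?e r) (\<lambda>c1 c2. R (?e p) c1 * R (?e q) c2)"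
      and a: "a \<in> hspace H" "b \<in> hspace H" "c \<in> hspace H"
    show "R (hmult H a b) c = sweedler (*) H c (\<lambda>c1 c2. R a c1 * R b c2)"
      by (rule trilinear_eqI[where B = ?B and s = "(*)" and v = a and w = b and u = c])
        (use * a mult_closed in \<open>auto simp: bilinear_from_def
          intro!: linear_intros linear_from_form_left linear_from_form_right dest!: comult_basis_mem\<close>)
  qed auto
  finally show ?thesis .
qed

text \<open>
  For \<open>a = p\<^sub>g # f\<close> and \<open>b = p\<^sub>h # f'\<close> both sides of the commutation rule are double sums over \<open>x, y \<in> G\<close>. On
  the left a summand lies in the \<open>p\<^sub>x\<close>-component and is nonzero only if \<open>y = x \<triangleleft> f\<close>. On the right it lies in
  the \<open>p\<^sub>l\<close>-component for \<open>l = h y\<^sup>-\<^sup>1\<close>, and \<open>(h y\<^sup>-\<^sup>1) \<triangleleft> (y \<triangleright> f') = g x\<^sup>-\<^sup>1\<close> determines \<open>x\<close>. So each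
  \<open>p\<^sub>l\<close>-component has one term on either side, and these two terms are those of \<^const>\<open>CQT3\<close>.
\<close>

lemma form_commute_basis_iff:
  assumes g: "g \<in> carrier G" and h: "h \<in> carrier G" and f: "f \<in> carrier F" and f': "f' \<in> carrier F"
  shows "sweedler fscale H (g \<sharp> f) (\<lambda>a1 a2. sweedler fscale H (h \<sharp> f') (\<lambda>b1 b2.
             fscale (R a1 b1) (hmult H a2 b2))) =
         sweedler fscale H (g \<sharp> f) (\<lambda>a1 a2. sweedler fscale H (h \<sharp> f') (\<lambda>b1 b2.
             fscale (R a2 b2) (hmult H b1 a1))) \<longleftrightarrow>
    (\<forall>l\<in>carrier G. let y = inv l \<otimes> h; x = ((inv l \<otimes> h) \<triangleleft> f') \<otimes> inv (h \<triangleleft> f') \<otimes> g in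
      fscale (\<tau> (g \<otimes> inv l) l f * \<tau> (h \<otimes> inv (l \<triangleleft> f)) (l \<triangleleft> f) f' *
         R ((g \<otimes> inv l) \<sharp> (l \<triangleright> f)) ((h \<otimes> inv (l \<triangleleft> f)) \<sharp> ((l \<triangleleft> f) \<triangleright> f')) * \<sigma> l f f')
        (Poly_Mapping.single (f \<otimes>\<^bsub>F\<^esub> f') 1) =
      fscale (\<tau> ((h \<triangleleft> f') \<otimes> inv (y \<triangleleft> f')) x f * \<tau> l y f' * R (x \<sharp> f) (y \<sharp> f') *
         \<sigma> l (y \<triangleright> f') (x \<triangleright> f))
        (Poly_Mapping.single ((y \<triangleright> f') \<otimes>\<^bsub>F\<^esub> (x \<triangleright> f)) 1))" (is "?L = ?R \<longleftrightarrow> _")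
proof -
  note [simp] = ract_closed lact_closed
  let ?y = "\<lambda>l. inv l \<otimes> h"
  let ?x = "\<lambda>l. (?y l \<triangleleft> f') \<otimes> inv (h \<triangleleft> f') \<otimes> g"
  let ?c = "\<lambda>l. \<tau> (g \<otimes> inv l) l f * \<tau> (h \<otimes> inv (l \<triangleleft> f)) (l \<triangleleft> f) f' *
         R ((g \<otimes> inv l) \<sharp> (l \<triangleright> f)) ((h \<otimes> inv (l \<triangleleft> f)) \<sharp> ((l \<triangleleft> f) \<triangleright> f')) * \<sigma> l f f'"
  let ?d = "\<lambda>l. \<tau> ((h \<triangleleft> f') \<otimes> inv (?y l \<triangleleft> f')) (?x l) f * \<tau> l (?y l) f' * R (?x l \<sharp> f) (?y l \<sharp> f') *
         \<sigma> l (?y l \<triangleright> f') (?x l \<triangleright> f)"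
  have "?L = (\<Sum>l\<in>carrier G. \<Sum>y\<in>carrier G. Poly_Mapping.single (l, f \<otimes>\<^bsub>F\<^esub> f')
      (\<tau> (g \<otimes> inv l) l f * (\<tau> (h \<otimes> inv y) y f' * (R ((g \<otimes> inv l) \<sharp> (l \<triangleright> f)) ((h \<otimes> inv y) \<sharp> (y \<triangleright> f')) *
        (of_bool (l \<triangleleft> f = y) * \<sigma> l f f')))))"
    by (simp add: sweedler_single hmult_single fscale_sum)
  also have "\<dots> = (\<Sum>l\<in>carrier G. Poly_Mapping.single (l, f \<otimes>\<^bsub>F\<^esub> f') (?c l))"
    using f finite_G
    by (intro sum.cong refl, subst sum_eq_single_term[where a = "_ \<triangleleft> f"]) (auto simp: mult.assoc)
  finally have L: "?L = \<dots>" .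
  \<comment> \<open>The sum over \<open>y\<close> is reindexed by \<open>l = h y\<^sup>-\<^sup>1\<close>, so that its index is the component of the summand.\<close>
  have "?R = (\<Sum>x\<in>carrier G. \<Sum>y\<in>carrier G.
      Poly_Mapping.single (h \<otimes> inv y, y \<triangleright> f' \<otimes>\<^bsub>F\<^esub> x \<triangleright> f)
      (\<tau> (g \<otimes> inv x) x f * (\<tau> (h \<otimes> inv y) y f' * (R (x \<sharp> f) (y \<sharp> f') *
        (of_bool ((h \<otimes> inv y) \<triangleleft> (y \<triangleright> f') = g \<otimes> inv x) * \<sigma> (h \<otimes> inv y) (y \<triangleright> f') (x \<triangleright> f))))))"
    by (simp add: sweedler_single hmult_single fscale_sum)
  also have "\<dots> = (\<Sum>y\<in>carrier G. \<Sum>x\<in>carrier G.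
      Poly_Mapping.single (h \<otimes> inv y, y \<triangleright> f' \<otimes>\<^bsub>F\<^esub> x \<triangleright> f)
      (\<tau> (g \<otimes> inv x) x f * (\<tau> (h \<otimes> inv y) y f' * (R (x \<sharp> f) (y \<sharp> f') *
        (of_bool ((h \<otimes> inv y) \<triangleleft> (y \<triangleright> f') = g \<otimes> inv x) * \<sigma> (h \<otimes> inv y) (y \<triangleright> f') (x \<triangleright> f))))))"
    by (rule sum.swap)
  also have "\<dots> = (\<Sum>l\<in>carrier G. \<Sum>x\<in>carrier G.
      Poly_Mapping.single (l, ?y l \<triangleright> f' \<otimes>\<^bsub>F\<^esub> x \<triangleright> f)
      (\<tau> (g \<otimes> inv x) x f * (\<tau> l (?y l) f' * (R (x \<sharp> f) (?y l \<sharp> f') *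
        (of_bool (l \<triangleleft> (?y l \<triangleright> f') = g \<otimes> inv x) * \<sigma> l (?y l \<triangleright> f') (x \<triangleright> f))))))"
    by (rule sum.reindex_bij_witness[where i = ?y and j = "\<lambda>y. h \<otimes> inv y"])
      (use h in \<open>auto simp: G.m_assoc G.inv_mult_group inv_mult_cancel\<close>)
  also have "\<dots> = (\<Sum>l\<in>carrier G. Poly_Mapping.single (l, ?y l \<triangleright> f' \<otimes>\<^bsub>F\<^esub> ?x l \<triangleright> f) (?d l))"
  proof (intro sum.cong refl)
    fix l assume l: "l \<in> carrier G"
    have act: "l \<triangleleft> (?y l \<triangleright> f') = h \<triangleleft> f' \<otimes> inv (?y l \<triangleleft> f')"
      using ract_quotient[of h "?y l" f'] l h f' by (simp add: G.m_assoc G.inv_mult_group inv_mult_cancel)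
    have x: "h \<triangleleft> f' \<otimes> inv (?y l \<triangleleft> f') = g \<otimes> inv x \<longleftrightarrow> x = ?x l" if "x \<in> carrier G" for x
      by (rule quotient_eq_quotient_iff) (use l g h f' that in simp_all)
    have gx: "g \<otimes> inv (?x l) = h \<triangleleft> f' \<otimes> inv (?y l \<triangleleft> f')"
      using x[of "?x l"] l g h f' by simp
    show "(\<Sum>x\<in>carrier G.
      Poly_Mapping.single (l, ?y l \<triangleright> f' \<otimes>\<^bsub>F\<^esub> x \<triangleright> f)
      (\<tau> (g \<otimes> inv x) x f * (\<tau> l (?y l) f' * (R (x \<sharp> f) (?y l \<sharp> f') *
        (of_bool (l \<triangleleft> (?y l \<triangleright> f') = g \<otimes> inv x) * \<sigma> l (?y l \<triangleright> f') (x \<triangleright> f)))))) =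
      Poly_Mapping.single (l, ?y l \<triangleright> f' \<otimes>\<^bsub>F\<^esub> ?x l \<triangleright> f) (?d l)"
      using l g h f' finite_G
      by (subst sum_eq_single_term[where a = "?x l"]) (simp_all add: act x gx mult.assoc)
  qed
  finally have R: "?R = \<dots>" .
  show ?thesis
    unfolding L R sum_single_eq_iff[OF finite_G] Let_def by simp
qed

lemma CQT3_iff:
  "CQT3 G F ract lact \<sigma> \<tau> R \<longleftrightarrow> (\<forall>a\<in>hspace H. \<forall>b\<in>hspace H.
    sweedler fscale H a (\<lambda>a1 a2. sweedler fscale H b (\<lambda>b1 b2. fscale (R a1 b1) (hmult H a2 b2))) =
    sweedler fscale H a (\<lambda>a1 a2. sweedler fscale H b (\<lambda>b1 b2. fscale (R a2 b2) (hmult H b1 a1))))"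
proof -
  let ?B = "carrier G \<times> carrier F"
  let ?e = "\<lambda>p. Poly_Mapping.single p 1"
  let ?L = "\<lambda>a b. sweedler fscale H a (\<lambda>a1 a2. sweedler fscale H b (\<lambda>b1 b2.
    fscale (R a1 b1) (hmult H a2 b2)))"
  let ?R = "\<lambda>a b. sweedler fscale H a (\<lambda>a1 a2. sweedler fscale H b (\<lambda>b1 b2.
    fscale (R a2 b2) (hmult H b1 a1)))"
  have "CQT3 G F ract lact \<sigma> \<tau> R \<longleftrightarrow> (\<forall>g\<in>carrier G. \<forall>h\<in>carrier G. \<forall>f\<in>carrier F. \<forall>f'\<in>carrier F.
      ?L (g \<sharp> f) (h \<sharp> f') = ?R (g \<sharp> f) (h \<sharp> f'))"
    unfolding CQT3_def by (simp add: form_commute_basis_iff cong: ball_cong) blast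
  also have "\<dots> \<longleftrightarrow> (\<forall>a\<in>hspace H. \<forall>b\<in>hspace H. ?L a b = ?R a b)"
  proof (intro iffI ballI)
    fix a b assume *: "\<forall>g\<in>carrier G. \<forall>h\<in>carrier G. \<forall>f\<in>carrier F. \<forall>f'\<in>carrier F.
      ?L (g \<sharp> f) (h \<sharp> f') = ?R (g \<sharp> f) (h \<sharp> f')"
      and a: "a \<in> hspace H" "b \<in> hspace H"
    show "?L a b = ?R a b"
      by (rule bilinear_eqI[where B = ?B and s = fscale and v = a and w = b])
        (use * a in \<open>auto simp: bilinear_from_def intro!: linear_intros\<close>)
  qed auto
  finally show ?thesis .
qed

lemma CQT4_imp:
  assumes "CQT4 G F lact \<tau> R" and a: "a \<in> hspace H" and b: "b \<in> hspace H"
  shows "sweedler (*) H a (\<lambda>a1 a2. sweedler (*) H b (\<lambda>b1 b2. R a1 b1 * R b2 a2)) =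
    counit H a * counit H b"
proof (rule bilinear_eqI[where B = "carrier G \<times> carrier F" and s = "(*)" and v = a and w = b])
  fix p q assume "p \<in> carrier G \<times> carrier F" "q \<in> carrier G \<times> carrier F"
  then show "sweedler (*) H (Poly_Mapping.single p 1) (\<lambda>a1 a2.
      sweedler (*) H (Poly_Mapping.single q 1) (\<lambda>b1 b2. R a1 b1 * R b2 a2)) =
    counit H (Poly_Mapping.single p 1) * counit H (Poly_Mapping.single q 1)"
    using assms(1)
    by (auto simp: CQT4_def sweedler_single counit_single sum_distrib_left mult.assoc)
qed (use a b in \<open>auto simp: bilinear_from_def intro!: linear_intros\<close>)

lemma coquasitriangular_iff:
  "coquasitriangular H R \<longleftrightarrow>
    CQT0 G F R \<and> CQT1 G F ract lact \<sigma> \<tau> R \<and> CQT2 G F ract lact \<sigma> \<tau> R \<and> CQT3 G F ract lact \<sigma> \<tau> R"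
proof
  assume "coquasitriangular H R"
  then interpret coquasitriangular H R .
  show "CQT0 G F R \<and> CQT1 G F ract lact \<sigma> \<tau> R \<and> CQT2 G F ract lact \<sigma> \<tau> R \<and> CQT3 G F ract lact \<sigma> \<tau> R"
    unfolding CQT0_iff CQT1_iff CQT2_iff CQT3_iff
    using form_unit form_mult_right form_mult_left form_commute by blast
next
  assume *: "CQT0 G F R \<and> CQT1 G F ract lact \<sigma> \<tau> R \<and> CQT2 G F ract lact \<sigma> \<tau> R \<and> CQT3 G F ract lact \<sigma> \<tau> R"
  show "coquasitriangular H R"
  proof
    show "bilinear_form (hbasis H) R"
      using R by simp
    then show "convolution_invertible H R"
      by (rule convolution_invertible_if_multiplicative) (use * CQT0_iff CQT2_iff in blast)+
  qed (use * CQT1_iff CQT2_iff CQT3_iff in blast)+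
qed

end

end

theorem proposition4p1:
  fixes G :: "('g, 'm) monoid_scheme" and F :: "('f, 'n) monoid_scheme"
    and ract :: "'g \<Rightarrow> 'f \<Rightarrow> 'g" and lact :: "'g \<Rightarrow> 'f \<Rightarrow> 'f"
    and \<sigma> :: "'g \<Rightarrow> 'f \<Rightarrow> 'f \<Rightarrow> 'k::{alg_closed_field, field_char_0}"
    and \<tau> :: "'g \<Rightarrow> 'g \<Rightarrow> 'f \<Rightarrow> 'k"
    and R :: "('g \<times> 'f \<Rightarrow>\<^sub>0 'k) \<Rightarrow> ('g \<times> 'f \<Rightarrow>\<^sub>0 'k) \<Rightarrow> 'k"
  assumes "finite (carrier G)"
    and "matched_pair_cocycles G F ract lact \<sigma> \<tau>"
    and "bilinear_form (carrier G \<times> carrier F) R"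
  shows "(coquasitriangular (bicrossed_product G F ract lact \<sigma> \<tau>) R \<longleftrightarrow>
      CQT0 G F R \<and> CQT1 G F ract lact \<sigma> \<tau> R \<and> CQT2 G F ract lact \<sigma> \<tau> R \<and>
      CQT3 G F ract lact \<sigma> \<tau> R) \<and>
    (CQT0 G F R \<and> CQT1 G F ract lact \<sigma> \<tau> R \<and> CQT2 G F ract lact \<sigma> \<tau> R \<and>
      CQT3 G F ract lact \<sigma> \<tau> R \<and> CQT4 G F lact \<tau> R \<longrightarrow>
      cotriangular (bicrossed_product G F ract lact \<sigma> \<tau>) R)"
proof -
  interpret finite_bicrossed_product G F ract lact \<sigma> \<tau>
    using assms(1,2) by (simp add: finite_bicrossed_product_def finite_bicrossed_product_axioms_def)
  show ?thesis
    using coquasitriangular_iff[OF assms(3)] CQT4_imp[OF assms(3)]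
    by (auto simp: cotriangular_def cotriangular_axioms_def)
qed

end
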